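(* Let $r_M>0$ and let $r:(0,\infty)\times[0,r_M]\to\mathbb{R}$ satisfy $0\le r(x,I)\le r_M$ for all $x>0$, $I\in[0,r_M]$, $\frac{\partial r}{\partial I}\in L^\infty((0,\infty)\times(0,r_M))$, and $r(x,I)\ge r_0$ for some constant $r_0>0$. Let $d>0$, $\gamma=\|\partial_Ir\|_\infty>0$, and assume $$\omega(\gamma):=\gamma\Big(\frac{3r_M}{r_0}+1\Big)<1.$$ Then one can find a constant $\lambda=\lambda(\gamma)>0$ such that, for every $n_{\rm ini}\in L^1(0,\infty)$ with $n_{\rm ini}\ge0$, $\int_0^\infty n_{\rm ini}=1$ and every constant $I_{\rm ini}\in[0,r_M]$, the solution $n$, with activity $I$, of the delayed equation $$\begin{cases}\partial_t n(t,x)+\partial_x n(t,x)+r(x,I(t-d))\,n(t,x)=0, & t,x\ge0,\\ I(t)=\int_0^\infty r(x,I(t-d))\,n(t,x)\,dx, & t\geq 0,\\ n(t,x=0)=I(t),\\ n(t=0)=n_{\rm ini},\\ I(t)=I_{\rm ini}, & t\in[-d,0),\end{cases}$$ satisfies for all $t\ge0$ $$|I(t)-\overline I|\le\frac{2r_M}{\omega(\gamma)}e^{-\lambda t}\quad\text{and}\quad\|n(t)-\overline n\|_1\le\frac{2}{\omega(\gamma)}e^{-\lambda t},$$ where $(\overline n,\overline I)$ is the mass $1$ steady state.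
   Context: Notation: $\|u\|_1=\int_0^\infty|u(x)|\,dx$. The rate function $r$ and the delay $d$ are fixed, and $\lambda$ may depend on them. With $R(x,I)=\int_0^x r(y,I)\,dy$, the mass $1$ steady state is a pair $(\overline n,\overline I)$ with $\overline I\in[0,r_M]$, $\overline I=\big(\int_0^\infty e^{-R(x,\overline I)}dx\big)^{-1}$ and $\overline n(x)=\overline Ie^{-R(x,\overline I)}$. A solution of the delayed equation is $n\in C([0,\infty);L^1(0,\infty))$ with $n\ge0$, $\int_0^\infty n(t,x)dx=1$, together with a measurable activity $I:[-d,\infty)\to[0,r_M]$; the transport equation is understood in the weak sense (by characteristics): $n(t,x)=n_{\rm ini}(x-t)\exp(-\int_0^t r(x-t+s,I(s-d))ds)$ for $x\ge t$ and $n(t,x)=I(t-x)\exp(-\int_0^x r(s,I(t-x+s-d))ds)$ for $x<t$. *)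

theory Defs
  imports "HOL-Analysis.Analysis" "HOL-Probability.Essential_Supremum"
begin

text \<open>Throughout, functions on \<open>(0, \<infinity>)\<close>, \<open>[-d, \<infinity>)\<close> etc. are total HOL functions whose values
  outside the relevant set are irrelevant. All integrals are Lebesgue integrals, and measurability
  is Lebesgue measurability.\<close>

definition Linf :: "'a measure \<Rightarrow> ('a \<Rightarrow> real) \<Rightarrow> bool" where
  "Linf M f \<longleftrightarrow> f \<in> borel_measurable M \<and> esssup M (\<lambda>x. ereal \<bar>f x\<bar>) < \<infinity>"

definition Linf_norm :: "'a measure \<Rightarrow> ('a \<Rightarrow> real) \<Rightarrow> real" where
  "Linf_norm M f = real_of_ereal (esssup M (\<lambda>x. ereal \<bar>f x\<bar>))"

definition L1_norm :: "(real \<Rightarrow> real) \<Rightarrow> real" where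
  "L1_norm u = (LINT x:{0<..}|lebesgue. \<bar>u x\<bar>)"

definition L1_loc :: "(real \<times> real) set \<Rightarrow> (real \<times> real \<Rightarrow> real) \<Rightarrow> bool" where
  "L1_loc \<Omega> f \<longleftrightarrow> (\<forall>K. compact K \<and> K \<subseteq> \<Omega> \<longrightarrow> set_integrable lebesgue K f)"

definition C1_compact_support :: "(real \<times> real) set \<Rightarrow> (real \<times> real \<Rightarrow> real) \<Rightarrow> bool" where
  "C1_compact_support \<Omega> \<phi> \<longleftrightarrow>
     (\<exists>D :: real \<times> real \<Rightarrow> (real \<times> real) \<Rightarrow>\<^sub>L real.
        continuous_on UNIV D \<and> (\<forall>p. (\<phi> has_derivative blinfun_apply (D p)) (at p))) \<and>
     (\<exists>K. compact K \<and> K \<subseteq> \<Omega> \<and> (\<forall>p. p \<notin> K \<longrightarrow> \<phi> p = 0))"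

text \<open>\<open>g\<close> is the partial derivative of \<open>f\<close> with respect to its second argument on the open
  set \<open>\<Omega>\<close>, in the weak sense. Testing against \<open>C\<^sup>1\<close> functions with compact support is
  equivalent to testing against \<open>C\<^sup>\<infinity>\<close> ones, by mollification. This
  determines \<open>f\<close> only almost everywhere; where the values \<open>f x I\<close> matter pointwise, continuity
  of \<open>f x\<close> for almost every \<open>x\<close> has to be required in addition to select the representative.\<close>

definition weak_deriv_snd ::
    "(real \<times> real) set \<Rightarrow> (real \<Rightarrow> real \<Rightarrow> real) \<Rightarrow> (real \<times> real \<Rightarrow> real) \<Rightarrow> bool" where
  "weak_deriv_snd \<Omega> f g \<longleftrightarrow>
     L1_loc \<Omega> (\<lambda>(x, I). f x I) \<and> L1_loc \<Omega> g \<and>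
     (\<forall>\<phi>. C1_compact_support \<Omega> \<phi> \<longrightarrow>
        (LINT p:\<Omega>|lebesgue. f (fst p) (snd p) * deriv (\<lambda>J. \<phi> (fst p, J)) (snd p))
        = - (LINT p:\<Omega>|lebesgue. g p * \<phi> p))"

definition prob_density :: "(real \<Rightarrow> real) \<Rightarrow> bool" where
  "prob_density u \<longleftrightarrow>
     set_integrable lebesgue {0<..} u \<and> (AE x in lebesgue. x > 0 \<longrightarrow> u x \<ge> 0) \<and>
     (LINT x:{0<..}|lebesgue. u x) = 1"

definition cum_rate :: "(real \<Rightarrow> real \<Rightarrow> real) \<Rightarrow> real \<Rightarrow> real \<Rightarrow> real" where
  "cum_rate r x I = (LINT y:{0..x}|lebesgue. r y I)"

definition steady_state ::
    "(real \<Rightarrow> real \<Rightarrow> real) \<Rightarrow> real \<Rightarrow> (real \<Rightarrow> real) \<Rightarrow> real \<Rightarrow> bool" where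
  "steady_state r r\<^sub>M nbar Ibar \<longleftrightarrow>
     Ibar \<in> {0..r\<^sub>M} \<and>
     Ibar = inverse (LINT x:{0<..}|lebesgue. exp (- cum_rate r x Ibar)) \<and>
     (\<forall>x>0. nbar x = Ibar * exp (- cum_rate r x Ibar))"

text \<open>\<open>n\<close>, with activity \<open>I\<close>, solves the delayed equation. The transport equation, together with
  its boundary value \<open>I\<close> at \<open>x = 0\<close> and its initial value, is expressed by the formula along
  characteristics, as an identity of elements of \<open>L\<^sup>1(0, \<infinity>)\<close> for each \<open>t\<close>. The limit condition on \<open>L1_norm\<close> says
  \<open>n \<in> C([0, \<infinity>); L\<^sup>1(0, \<infinity>))\<close>.\<close>

definition delayed_solution ::
    "(real \<Rightarrow> real \<Rightarrow> real) \<Rightarrow> real \<Rightarrow> real \<Rightarrow> (real \<Rightarrow> real) \<Rightarrow> real \<Rightarrow>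
     (real \<Rightarrow> real \<Rightarrow> real) \<Rightarrow> (real \<Rightarrow> real) \<Rightarrow> bool" where
  "delayed_solution r r\<^sub>M d n_ini I_ini n I \<longleftrightarrow>
     I \<in> borel_measurable (lebesgue_on {-d..}) \<and> (\<forall>t\<ge>-d. I t \<in> {0..r\<^sub>M}) \<and>
     (\<forall>t\<ge>0. prob_density (n t)) \<and>
     (\<forall>t\<ge>0. ((\<lambda>s. L1_norm (\<lambda>x. n s x - n t x)) \<longlongrightarrow> 0) (at t within {0..})) \<and>
     (\<forall>t\<ge>0. AE x in lebesgue. x > 0 \<longrightarrow>
        n t x =
          (if x \<ge> t
           then n_ini (x - t) * exp (- (LINT s:{0..t}|lebesgue. r (x - t + s) (I (s - d))))
           else I (t - x) * exp (- (LINT s:{0..x}|lebesgue. r s (I (t - x + s - d)))))) \<and>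
     (AE x in lebesgue. x > 0 \<longrightarrow> n 0 x = n_ini x) \<and>
     (\<forall>t\<ge>0. I t = (LINT x:{0<..}|lebesgue. r x (I (t - d)) * n t x)) \<and>
     (\<forall>t. -d \<le> t \<and> t < 0 \<longrightarrow> I t = I_ini)"

definition omega :: "real \<Rightarrow> real \<Rightarrow> real \<Rightarrow> real" where
  "omega r\<^sub>M r\<^sub>0 \<gamma> = \<gamma> * (3 * r\<^sub>M / r\<^sub>0 + 1)"

end

theory Submission
  imports Defs
begin

text \<open>
The proof is a coupling argument. Follow along characteristics the neurons that have fired since
time \<open>0\<close>. A neuron that fires at time \<open>b\<close> is counted with weight \<open>\<kappa> b = min (I b) Ibar\<close>, the
largest amount by which both the solution and the steady state are renewed at that time.
Afterwards its rate differs from the stationary rate \<open>\<rho> x = r x Ibar\<close> by at most \<open>q s = \<gamma> * \<bar>I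
(s - d) - Ibar\<bar>\<close>, since \<open>r x\<close> is \<open>\<gamma>\<close>-Lipschitz for almost every \<open>x\<close>. Hence \<open>W t x = \<kappa> (t - x) *
exp (- (\<integral>\<^sub>0\<^sup>x \<rho>) - (\<integral>\<^bsub>t - x\<^esub>\<^bsup>t\<^esup> q))\<close> for \<open>x < t\<close>, and \<open>W t x = 0\<close> for \<open>x > t\<close>, lies below both
\<open>n t\<close> and \<open>nbar\<close>. It solves a linear renewal problem whose damping separates into a function of
age and a function of time.

Let \<open>w t = 1 - \<integral> W t\<close> be the uncoupled mass. The integral of \<open>\<bar>n - nbar\<bar>\<close> is at most \<open>2 * w t\<close>,
and \<open>\<bar>I t - Ibar\<bar> \<le> \<gamma> * \<bar>I (t - d) - Ibar\<bar> + r\<^sub>M * w t\<close>. Since uncoupled neurons fire at rate at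
least \<open>r\<^sub>0\<close>, they are coupled at that rate, up to an error \<open>q\<close> in the coupled births and another
\<open>q\<close> in the damping of \<open>W\<close>: \<open>w t \<le> exp (- r\<^sub>0 * t) + 2 * (\<integral>\<^sub>0\<^sup>t q s * exp (- r\<^sub>0 * (t - s)) ds)\<close>.
These facts are \<open>common_part_estimates\<close>, \<open>renewed_overlap_lower_bound\<close> and, for a solution,
\<open>delayed_solution_estimates\<close>.

The two inequalities close by induction on intervals of length \<open>d\<close>. Write \<open>\<omega> = omega r\<^sub>M r\<^sub>0 \<gamma>\<close>.
If \<open>\<bar>I s - Ibar\<bar> \<le> (4 * r\<^sub>M / (3 * \<omega>)) * exp (- l * s)\<close> for all \<open>s \<le> t - d\<close> and \<open>l\<close> is small,
then \<open>w t \<le> exp (- l * t) / \<omega>\<close>, because \<open>3 * \<gamma> * r\<^sub>M < r\<^sub>0\<close>; and then the bound on the activity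
holds at time \<open>t\<close>, because \<open>4 * \<gamma> < 1\<close>. Both inequalities follow from \<open>\<omega> < 1\<close> and \<open>r\<^sub>0 \<le> r\<^sub>M\<close>.
On \<open>[-d, 0)\<close> the bound holds because \<open>\<bar>I s - Ibar\<bar> \<le> r\<^sub>M\<close> and \<open>\<omega> < 1\<close>.

The Lipschitz bound has to be extracted from the weak derivative. Testing with products of
plateau functions in \<open>x\<close> and in \<open>I\<close>, and letting the plateau in \<open>x\<close> converge to the indicator of
an interval, bounds almost every slice integral \<open>\<integral> r x y * \<beta>' y dy\<close>; letting the plateau in \<open>I\<close>
sharpen turns \<open>\<beta>'\<close> into a difference of two Dirac masses (\<open>AE_lipschitz_if_weak_deriv_bounded\<close>).
\<close>

section \<open>Integrals over bounded intervals\<close>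

lemma set_integrable_bounded_Icc:
  fixes f :: "real \<Rightarrow> real"
  assumes [measurable]: "f \<in> borel_measurable borel" "S \<in> sets borel" and "S \<subseteq> {a..b}"
    and B: "\<And>x. x \<in> S \<Longrightarrow> \<bar>f x\<bar> \<le> K"
  shows "set_integrable lborel S f"
proof -
  have S: "emeasure lborel S < \<infinity>"
    by (rule order.strict_trans1[OF emeasure_mono[OF assms(3)]]) (cases "a \<le> b"; simp)+
  have "integrable lborel (\<lambda>x. K * indicator S x)"
    using S by (intro integrable_mult_right integrable_real_indicator) auto
  then show ?thesis
    unfolding set_integrable_def
    by (rule Bochner_Integration.integrable_bound) (use B in \<open>auto simp: indicator_def intro!: AE_I2 order_trans[OF B]\<close>)
qed

lemma abs_set_integral_Icc_le:
  fixes f :: "real \<Rightarrow> real"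
  assumes "f \<in> borel_measurable borel" "a \<le> b" and B: "\<And>x. x \<in> {a<..b} \<Longrightarrow> \<bar>f x\<bar> \<le> K"
  shows "\<bar>LBINT x:{a<..b}. f x\<bar> \<le> K * (b - a)"
proof -
  have "set_integrable lborel {a<..b} f"
    by (rule set_integrable_bounded_Icc[OF assms(1), where a=a and b=b and K=K]) (use B in auto)
  then have "\<bar>LBINT x:{a<..b}. f x\<bar> \<le> (LBINT x:{a<..b}. \<bar>f x\<bar>)"
    using set_integral_norm_bound[of lborel "{a<..b}" f] by simp
  also have "\<dots> \<le> (LBINT x:{a<..b}. K)"
  proof (rule set_integral_mono)
    show "set_integrable lborel {a<..b} (\<lambda>x. \<bar>f x\<bar>)"
      by (rule set_integrable_abs) fact
    show "set_integrable lborel {a<..b} (\<lambda>x. K)"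
      by (rule set_integrable_bounded_Icc[where a=a and b=b and K="\<bar>K\<bar>"]) auto
  qed (rule B)
  also have "\<dots> = K * (b - a)"
    using assms(2) by (subst set_integral_const) (auto simp: mult.commute)
  finally show ?thesis .
qed

lemma set_integral_Icc_split:
  fixes f :: "real \<Rightarrow> real"
  assumes "f \<in> borel_measurable borel" "a \<le> b" "b \<le> c" and B: "\<And>x. x \<in> {a..c} \<Longrightarrow> \<bar>f x\<bar> \<le> K"
  shows "(LBINT x:{a..c}. f x) = (LBINT x:{a..b}. f x) + (LBINT x:{b<..c}. f x)"
proof -
  have "{a..c} = {a..b} \<union> {b<..c}" "{a..b} \<inter> {b<..c} = {}" using assms(2,3) by auto
  moreover have "set_integrable lborel {a..b} f" "set_integrable lborel {b<..c} f"
    by (rule set_integrable_bounded_Icc[OF assms(1), where a=a and b=c and K=K]; use assms(2,3) B in force)+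
  ultimately show ?thesis by (simp add: set_integral_Un)
qed

text \<open>
Quadratic increments give derivative \<open>0\<close> at every point. The lemma is meant for differences of
indefinite integrals whose integrands are merely measurable and bounded.
\<close>

lemma constant_if_quadratic_increments:
  fixes F :: "real \<Rightarrow> real"
  assumes "\<And>s t. 0 \<le> s \<Longrightarrow> s \<le> t \<Longrightarrow> t \<le> T \<Longrightarrow> \<bar>F t - F s\<bar> \<le> C * (t - s)\<^sup>2" "0 \<le> T"
  shows "F T = F 0"
proof -
  have *: "\<bar>F y - F x\<bar> \<le> C * (y - x)\<^sup>2" if "x \<in> {0..T}" "y \<in> {0..T}" for x y
    using assms(1)[of x y] assms(1)[of y x] that by (cases "x \<le> y") (auto simp: abs_minus_commute power2_commute)
  have "\<exists>c. \<forall>x\<in>{0..T}. F x = c"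
  proof (rule has_derivative_zero_constant)
    show "convex {0..T}" by simp
    fix x assume x: "x \<in> {0..T}"
    have "((\<lambda>y. (F y - F x) / (y - x)) \<longlongrightarrow> 0) (at x within {0..T})"
    proof (rule Lim_null_comparison)
      show "\<forall>\<^sub>F y in at x within {0..T}. norm ((F y - F x) / (y - x)) \<le> C * \<bar>y - x\<bar>"
        using *[OF x] by (auto simp: eventually_at_filter divide_le_eq power2_eq_square mult.assoc simp flip: abs_mult intro!: always_eventually)
      show "((\<lambda>y. C * \<bar>y - x\<bar>) \<longlongrightarrow> 0) (at x within {0..T})"
        by (auto intro!: tendsto_eq_intros)
    qed
    then show "(F has_derivative (\<lambda>h. 0)) (at x within {0..T})"
      using has_field_derivative_iff[of F 0 x "{0..T}"] by (simp add: has_field_derivative_def lambda_zero)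
  qed
  then show ?thesis using assms(2) by fastforce
qed

lemma continuous_on_indefinite_integral:
  fixes a :: "real \<Rightarrow> real"
  assumes a: "a \<in> borel_measurable borel" "\<And>x. \<bar>a x\<bar> \<le> K"
  shows "continuous_on UNIV (\<lambda>t. LBINT s:{0..t}. a s)"
proof -
  have K: "0 \<le> K" using a(2)[of 0] by linarith
  have *: "\<bar>(LBINT s:{0..t}. a s) - (LBINT s:{0..s}. a s)\<bar> \<le> K * \<bar>t - s\<bar>" if "s \<le> t" for s t
  proof (cases "0 \<le> s")
    case True
    then show ?thesis
      using set_integral_Icc_split[OF a(1), of 0 s t K] abs_set_integral_Icc_le[OF a(1), of s t K] a(2) that by simp
  next
    case s: False
    show ?thesis
    proof (cases "0 \<le> t")
      case True
      have "(LBINT s:{0..t}. a s) = (LBINT s:{0<..t}. a s)"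
        by (rule set_integral_cong_set) (use a(1) in \<open>auto simp: set_borel_measurable_def intro!: borel_measurable_times eventually_mono[OF AE_lborel_singleton[of 0]]\<close>)
      moreover have "K * t \<le> K * (t - s)" using K s by (intro mult_left_mono) auto
      ultimately show ?thesis using s True abs_set_integral_Icc_le[OF a(1), of 0 t K] a(2) that 
        by (simp add: set_lebesgue_integral_def)
    qed (use s K that in \<open>simp add: set_lebesgue_integral_def\<close>)
  qed
  have "K-lipschitz_on UNIV (\<lambda>t. LBINT s:{0..t}. a s)"
  proof (rule lipschitz_onI)
    fix x y :: real
    show "dist (LBINT s:{0..x}. a s) (LBINT s:{0..y}. a s) \<le> K * dist x y"
      using *[of x y] *[of y x] by (cases "x \<le> y") (auto simp: dist_real_def abs_minus_commute)
  qed (rule K)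
  then show ?thesis by (rule lipschitz_on_continuous_on)
qed

text \<open>
The identity says that \<open>a * exp A\<close> integrates to \<open>exp A\<close> although \<open>A\<close> need not be differentiable
at every point: over a step of length \<open>h\<close> both sides grow by \<open>exp (A s) * (A (s + h) - A s)\<close> up
to a term of order \<open>h\<^sup>2\<close>, so their difference is constant.
\<close>

lemma integral_exp_indefinite_integral:
  fixes a :: "real \<Rightarrow> real"
  assumes a: "a \<in> borel_measurable borel" "\<And>x. \<bar>a x\<bar> \<le> K" and "0 \<le> T"
  defines "A \<equiv> \<lambda>t. LBINT s:{0..t}. a s"
  shows "(LBINT s:{0..T}. a s * exp (A s)) = exp (A T) - 1"
proof -
  have K: "0 \<le> K" using a(2)[of 0] by linarith
  have A0: "A 0 = 0" 
    unfolding A_def set_lebesgue_integral_def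
    by (rule integral_eq_zero_AE) (auto intro!: eventually_mono[OF AE_lborel_singleton[of 0]])
  have A_diff: "A t - A s = (LBINT s:{s<..t}. a s)" if "0 \<le> s" "s \<le> t" for s t
    using set_integral_Icc_split[OF a(1), of 0 s t K] a(2) that by (simp add: A_def)
  have A_lip: "\<bar>A t - A s\<bar> \<le> K * (t - s)" if "0 \<le> s" "s \<le> t" for s t
    using A_diff[OF that] abs_set_integral_Icc_le[OF a(1), of s t K] a(2) that by simp
  have A_le: "\<bar>A t\<bar> \<le> K * T" if "0 \<le> t" "t \<le> T" for t
    using A_lip[of 0 t] A0 that mult_left_mono[OF that(2) K] by simp
  have Am: "A \<in> borel_measurable borel"
    unfolding A_def using continuous_on_indefinite_integral[OF a] by (rule borel_measurable_continuous_onI)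
  define f where "f = (\<lambda>s. a s * exp (A s))"
  have fm: "f \<in> borel_measurable borel" unfolding f_def using a Am by measurable
  have f_le: "\<bar>f s\<bar> \<le> K * exp (K * T)" if "s \<in> {0..T}" for s
    unfolding f_def abs_mult using A_le[of s] that a(2)[of s] K
    by (intro mult_mono) (auto simp: abs_le_iff)
  define F where "F t = exp (A t) - (LBINT s:{0..t}. f s)" for t
  have "F T = F 0"
  proof (rule constant_if_quadratic_increments[where C="K * exp (K * T) * K"])
    fix s t :: real assume st: "0 \<le> s" "s \<le> t" "t \<le> T"
    have exp_lip: "\<bar>exp u - exp v\<bar> \<le> exp (K * T) * \<bar>u - v\<bar>" if "u \<le> K * T" "v \<le> K * T" for u v
    proof -
      have "\<bar>exp u - exp v\<bar> \<le> exp (K * T) * \<bar>u - v\<bar>" if "u \<le> v" "v \<le> K * T" for u v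
      proof -
        have "exp v * (1 + (u - v)) \<le> exp v * exp (u - v)" by (intro mult_left_mono exp_ge_add_one_self) auto
        then have "exp v - exp u \<le> exp v * (v - u)" by (simp add: algebra_simps exp_diff)
        also have "\<dots> \<le> exp (K * T) * (v - u)" using that by (intro mult_right_mono) auto
        finally show ?thesis using that by simp
      qed
      from this[of u v] this[of v u] that show ?thesis by (cases "u \<le> v") (auto simp: abs_minus_commute)
    qed
    obtain xi where xi: "min (A s) (A t) \<le> xi" "xi \<le> max (A s) (A t)"
      "exp (A t) - exp (A s) = exp xi * (A t - A s)"
    proof (cases "A s = A t")
      case False
      have *: "\<exists>xi. u \<le> xi \<and> xi \<le> v \<and> exp v - exp u = exp xi * (v - u)" if "u < v" for u v :: real
        using MVT2[of u v exp exp] that by (force simp: mult.commute intro!: derivative_eq_intros)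
      show ?thesis
      proof (cases "A s < A t")
        case True
        then show ?thesis using *[OF True] that by (auto simp: min_def max_def)
      next
        case False
        then have "A t < A s" using \<open>A s \<noteq> A t\<close> by simp
        from *[OF this] obtain xi where "A t \<le> xi" "xi \<le> A s" "exp (A s) - exp (A t) = exp xi * (A s - A t)" by auto
        then show ?thesis using that[of xi] by (auto simp: min_def max_def algebra_simps)
      qed
    qed (use that[of "A s"] in auto)
    have xiT: "xi \<le> K * T" using xi(2) A_le[of s] A_le[of t] st by auto
    have "F t - F s = exp xi * (LBINT s:{s<..t}. a s) - (LBINT s:{s<..t}. f s)"
      unfolding F_def using set_integral_Icc_split[OF fm, of 0 s t "K * exp (K * T)"] f_le st xi(3) A_diff[of s t]
      by simp
    also have "\<dots> = (LBINT u:{s<..t}. exp xi * a u - f u)"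
    proof -
      have "set_integrable lborel {s<..t} a"
        by (rule set_integrable_bounded_Icc[where a=s and b=t and K=K]) (use a in auto)
      moreover have "set_integrable lborel {s<..t} f"
        by (rule set_integrable_bounded_Icc[where a=s and b=t and K="K * exp (K * T)"]) (use st fm f_le in auto)
      ultimately show ?thesis by (simp add: set_integral_diff)
    qed
    also have "\<bar>\<dots>\<bar> \<le> K * exp (K * T) * K * (t - s) * (t - s)"
    proof (rule abs_set_integral_Icc_le)
      fix u assume u: "u \<in> {s<..t}"
      have "\<bar>xi - A u\<bar> \<le> K * (t - s)"
      proof -
        have "\<bar>A u - A s\<bar> \<le> K * (t - s)" "\<bar>A t - A u\<bar> \<le> K * (t - s)"
          using A_lip[of s u] A_lip[of u t] u st K mult_left_mono[of "u - s" "t - s" K] mult_left_mono[of "t - u" "t - s" K] by auto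
        then show ?thesis using xi by (auto simp: min_def max_def split: if_splits)
      qed
      moreover have "\<bar>exp xi - exp (A u)\<bar> \<le> exp (K * T) * \<bar>xi - A u\<bar>"
        using xiT A_le[of u] u st by (intro exp_lip) auto
      ultimately have "\<bar>exp xi - exp (A u)\<bar> \<le> exp (K * T) * (K * (t - s))"
        by (meson order_trans mult_left_mono exp_ge_zero)
      then have "\<bar>a u\<bar> * \<bar>exp xi - exp (A u)\<bar> \<le> K * (exp (K * T) * (K * (t - s)))"
        using a(2)[of u] K by (intro mult_mono) auto
      then show "\<bar>exp xi * a u - f u\<bar> \<le> K * exp (K * T) * K * (t - s)"
        unfolding f_def by (simp add: abs_mult[symmetric] algebra_simps)
    qed (use st a fm in auto)
    finally show "\<bar>F t - F s\<bar> \<le> K * exp (K * T) * K * (t - s)\<^sup>2"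
      by (simp add: power2_eq_square)
  qed (rule \<open>0 \<le> T\<close>)
  moreover have "(LBINT s:{0..0}. f s) = 0"
    unfolding set_lebesgue_integral_def
    by (rule integral_eq_zero_AE) (auto intro!: eventually_mono[OF AE_lborel_singleton[of 0]])
  ultimately show ?thesis by (simp add: F_def f_def A0)
qed

section \<open>Bounded weak derivative implies Lipschitz\<close>

text \<open>
Cover the set where \<open>G \<le> - e\<close> by countably many non-overlapping intervals whose total length
exceeds its measure by at most \<open>\<eta>\<close>. On the union the positive part of \<open>G\<close> outweighs the negative
part, but the positive part vanishes on the covered set, so \<open>e\<close> times the measure of that set is
at most \<open>K * \<eta>\<close>.
\<close>

lemma AE_nonneg_if_interval_integrals_nonneg:
  fixes G :: "real \<Rightarrow> real"
  assumes G[measurable]: "G \<in> borel_measurable borel" and bound: "\<And>x. \<bar>G x\<bar> \<le> K"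
    and nonneg: "\<And>u v. c \<le> u \<Longrightarrow> u \<le> v \<Longrightarrow> v \<le> d \<Longrightarrow> 0 \<le> (LBINT x:{u<..v}. G x)"
  shows "AE x in lborel. x \<in> {c..d} \<longrightarrow> 0 \<le> G x"
proof -
  have K: "0 \<le> K" using bound[of 0] by linarith
  \<comment> \<open>the positive and the negative part of \<open>G\<close> as measures\<close>
  define P where "P = density lborel (\<lambda>x. ennreal (G x))"
  define M where "M = density lborel (\<lambda>x. ennreal (- G x))"
  have sets_PM [measurable_cong, simp]: "sets P = sets borel" "sets M = sets borel" by (auto simp: P_def M_def)
  have MP_Ioc: "emeasure M {u<..v} \<le> emeasure P {u<..v}" if uv: "c \<le> u" "u \<le> v" "v \<le> d" for u v
  proof -
    have si: "set_integrable lborel {u<..v} (\<lambda>x. max 0 (G x))" "set_integrable lborel {u<..v} (\<lambda>x. max 0 (- G x))"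
      by (rule set_integrable_bounded_Icc[where a=u and b=v and K=K]; use bound K in \<open>auto simp: max_def abs_le_iff\<close>)+
    have em: "emeasure P {u<..v} = ennreal (LBINT x:{u<..v}. max 0 (G x))"
      "emeasure M {u<..v} = ennreal (LBINT x:{u<..v}. max 0 (- G x))"
      unfolding P_def M_def set_lebesgue_integral_def
      by (subst emeasure_density; (subst nn_integral_eq_integral[symmetric])?;
          use si in \<open>auto simp: set_integrable_def indicator_def max_def ennreal_neg intro!: nn_integral_cong\<close>)+
    have "(LBINT x:{u<..v}. max 0 (G x)) - (LBINT x:{u<..v}. max 0 (- G x)) = (LBINT x:{u<..v}. G x)"
    proof -
      have "(\<lambda>x. max 0 (G x) - max 0 (- G x)) = G" by (auto simp: max_def fun_eq_iff)
      then show ?thesis using set_integral_diff(2)[OF si] by simp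
    qed
    then show ?thesis unfolding em using nonneg[OF uv] by (intro ennreal_leI) linarith
  qed
  have small: "{x \<in> {c..d}. G x \<le> - e} \<in> null_sets lborel" if e: "0 < e" for e
  proof -
    define S where "S = {x \<in> {c..d}. G x \<le> - e}"
    have S_borel [measurable]: "S \<in> sets borel" unfolding S_def by measurable
    have S_fin: "emeasure lborel S < \<infinity>"
      by (rule order.strict_trans1[OF emeasure_mono[of S "{c..d}"]]) (cases "c \<le> d"; auto simp: S_def)+
    have S_lm: "S \<in> lmeasurable"
      using S_fin S_borel by (auto simp: fmeasurable_def)
    have bd: "e * measure lborel S \<le> K * \<eta>" if \<eta>: "0 < \<eta>" for \<eta>
    proof -
      have S_cd: "S \<subseteq> cbox c d" by (auto simp: S_def)
      obtain \<D> where D: "countable \<D>"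
        "\<And>A. A \<in> \<D> \<Longrightarrow> A \<subseteq> cbox c d \<and> A \<noteq> {} \<and> (\<exists>u v. A = cbox u v)"
        "pairwise (\<lambda>A B. interior A \<inter> interior B = {}) \<D>"
        "S \<subseteq> \<Union>\<D>" "\<Union>\<D> \<in> lmeasurable" "measure lebesgue (\<Union>\<D>) \<le> measure lebesgue S + \<eta>"
        by (rule measurable_outer_intervals_bounded[OF S_lm S_cd \<eta>]) (rule that; assumption)
      \<comment> \<open>half-open intervals with disjoint interiors are disjoint, and only left end points are lost\<close>
      define J where "J A = {Inf A<..Sup A}" for A :: "real set"
      have A_eq: "A = {Inf A..Sup A} \<and> Inf A \<le> Sup A \<and> c \<le> Inf A \<and> Sup A \<le> d" if A: "A \<in> \<D>" for A
      proof -
        obtain u v where "A = {u..v}" "u \<le> v" using D(2)[OF A] by auto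
        then show ?thesis using D(2)[OF A] by auto
      qed
      have J_sub: "J A \<subseteq> A" if "A \<in> \<D>" for A
      proof
        fix x assume "x \<in> J A"
        then have "x \<in> {Inf A..Sup A}" by (simp add: J_def)
        then show "x \<in> A" using A_eq[OF that] by blast
      qed
      have disj: "disjoint_family_on J \<D>"
        unfolding disjoint_family_on_def
      proof (intro ballI impI)
        fix A B assume AB: "A \<in> \<D>" "B \<in> \<D>" "A \<noteq> B"
        have "interior A \<inter> interior B = {}"
          using pairwiseD[OF D(3) AB] .
        moreover have "interior A = {Inf A<..<Sup A}" "interior B = {Inf B<..<Sup B}"
          using A_eq[OF AB(1)] A_eq[OF AB(2)] interior_atLeastAtMost_real by metis+
        ultimately have *: "{Inf A<..<Sup A} \<inter> {Inf B<..<Sup B} = {}" by blast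
        show "J A \<inter> J B = {}"
        proof (rule ccontr)
          assume "J A \<inter> J B \<noteq> {}"
          then obtain x where x: "x \<in> J A" "x \<in> J B" by blast
          then have "Inf A < x" "x \<le> Sup A" "Inf B < x" "x \<le> Sup B" unfolding J_def by simp_all
          then have "(max (Inf A) (Inf B) + x) / 2 \<in> {Inf A<..<Sup A} \<inter> {Inf B<..<Sup B}"
            by (auto simp: max_def)
          with * show False by blast
        qed
      qed
      define U where "U = (\<Union>A\<in>\<D>. J A)"
      have J_borel: "J A \<in> sets borel" for A by (simp add: J_def)
      have U_borel [measurable]: "U \<in> sets borel"
        unfolding U_def using D(1) J_borel by (intro sets.countable_UN') auto
      have U_sub: "U \<subseteq> {c..d}" "U \<subseteq> \<Union>\<D>"
        unfolding U_def using D(2) J_sub by fastforce+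
      have "emeasure M U = (\<integral>\<^sup>+A. emeasure M (J A) \<partial>count_space \<D>)"
        unfolding U_def using D(1) disj J_borel by (intro emeasure_UN_countable) auto
      also have "\<dots> \<le> (\<integral>\<^sup>+A. emeasure P (J A) \<partial>count_space \<D>)"
        using A_eq by (intro nn_integral_mono) (auto simp: J_def intro: MP_Ioc)
      also have "\<dots> = emeasure P U"
        unfolding U_def using D(1) disj J_borel by (intro emeasure_UN_countable[symmetric]) auto
      finally have MP_U: "emeasure M U \<le> emeasure P U" .
      have null: "S - U \<in> null_sets lborel"
      proof (rule null_sets_subset)
        show "Inf ` \<D> \<in> null_sets lborel"
          using D(1) by (intro countable_imp_null_set_lborel) auto
        show "S - U \<subseteq> Inf ` \<D>"
        proof
          fix x assume x: "x \<in> S - U"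
          then obtain A where A: "A \<in> \<D>" "x \<in> A" using D(4) by auto
          then have "x \<in> {Inf A..Sup A}" using A_eq by blast
          moreover have "x \<notin> J A" using x A by (auto simp: U_def)
          ultimately have "x = Inf A" by (auto simp: J_def)
          then show "x \<in> Inf ` \<D>" using A by auto
        qed
      qed measurable
      have "ennreal e * emeasure lborel (S \<inter> U) \<le> emeasure M U"
      proof -
        have "ennreal e * emeasure lborel (S \<inter> U) = (\<integral>\<^sup>+x. ennreal e * indicator (S \<inter> U) x \<partial>lborel)"
          by (subst nn_integral_cmult_indicator) auto
        also have "\<dots> \<le> (\<integral>\<^sup>+x. ennreal (- G x) * indicator U x \<partial>lborel)"
          by (intro nn_integral_mono) (auto simp: S_def indicator_def intro!: ennreal_leI)
        finally show ?thesis unfolding M_def by (subst emeasure_density) auto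
      qed
      also note MP_U
      also have "emeasure P U \<le> ennreal K * emeasure lborel (U - S)"
      proof -
        have "emeasure P U = (\<integral>\<^sup>+x. ennreal (G x) * indicator U x \<partial>lborel)"
          unfolding P_def by (subst emeasure_density) auto
        also have "\<dots> \<le> (\<integral>\<^sup>+x. ennreal K * indicator (U - S) x \<partial>lborel)"
        proof (intro nn_integral_mono)
          fix x
          have "G x \<le> K" using bound[of x] by linarith
          moreover have "G x \<le> 0" if "x \<in> S" using that e by (auto simp: S_def)
          ultimately show "ennreal (G x) * indicator U x \<le> ennreal K * indicator (U - S) x"
            by (auto simp: indicator_def ennreal_neg intro!: ennreal_leI)
        qed
        also have "\<dots> = ennreal K * emeasure lborel (U - S)"
          by (subst nn_integral_cmult_indicator) auto
        finally show ?thesis .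
      qed
      finally have main: "ennreal e * emeasure lborel (S \<inter> U) \<le> ennreal K * emeasure lborel (U - S)" .
      have U_fm: "U \<in> fmeasurable lborel" "S \<in> fmeasurable lborel"
        using S_fin order.strict_trans1[OF emeasure_mono[OF U_sub(1), of lborel], of \<infinity>]
        by (cases "c \<le> d"; auto simp: fmeasurable_def S_def)+
      have SU: "S \<inter> U \<in> fmeasurable lborel" "U - S \<in> fmeasurable lborel"
        using U_fm by (auto intro: fmeasurable_Int_fmeasurable fmeasurable_Diff)
      have "e * measure lborel (S \<inter> U) \<le> K * measure lborel (U - S)"
        using main SU e K by (simp add: emeasure_eq_measure2 ennreal_mult[symmetric])
      moreover have "measure lborel (S \<inter> U) = measure lborel S"
      proof (rule measure_eq_AE)
        show "AE x in lborel. (x \<in> S \<inter> U) = (x \<in> S)"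
          using AE_not_in[OF null] by eventually_elim auto
      qed auto
      moreover have "measure lborel (U - S) = measure lborel U - measure lborel (S \<inter> U)"
      proof -
        have "S \<inter> U \<union> U = U" "U - S \<inter> U = U - S" by auto
        then show ?thesis using measure_Un2[OF SU(1) U_fm(1)] by simp
      qed
      moreover have "measure lborel U \<le> measure lborel S + \<eta>"
      proof -
        have "measure lborel U = measure lebesgue U" by simp
        also have "\<dots> \<le> measure lebesgue (\<Union>\<D>)"
          using U_sub(2) D(5) by (intro measure_mono_fmeasurable) auto
        also have "\<dots> \<le> measure lebesgue S + \<eta>" by fact
        finally show ?thesis by simp
      qed
      ultimately show ?thesis using mult_left_mono[of "measure lborel (U - S)" \<eta> K] K by simp
    qed
    have "e * measure lborel S \<le> 0"
    proof (rule field_le_epsilon)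
      fix \<eta> :: real assume "0 < \<eta>"
      then have "e * measure lborel S \<le> K * (\<eta> / (K + 1))" using K by (intro bd) auto
      also have "\<dots> \<le> \<eta>" using K \<open>0 < \<eta>\<close> by (simp add: field_simps)
      finally show "e * measure lborel S \<le> 0 + \<eta>" by simp
    qed
    then have "measure lborel S = 0" using e by (simp add: mult_le_0_iff measure_le_0_iff)
    then show ?thesis
      using S_fin unfolding S_def[symmetric]
      by (auto simp: null_sets_def measure_def enn2real_eq_0_iff)
  qed
  have "(\<Union>n. {x \<in> {c..d}. G x \<le> - inverse (Suc n)}) \<in> null_sets lborel"
    by (intro null_sets_UN small) simp
  from AE_not_in[OF this] show ?thesis
  proof eventually_elim
    case (elim x)
    show ?case
    proof (rule ccontr)
      assume "\<not> (x \<in> {c..d} \<longrightarrow> 0 \<le> G x)"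
      then have "x \<in> {c..d}" "0 < - G x" by auto
      moreover from reals_Archimedean[OF this(2)] obtain n where "inverse (real (Suc n)) < - G x" by auto
      moreover have "\<not> G x \<le> - inverse (real (Suc n))" using elim \<open>x \<in> {c..d}\<close> by blast
      ultimately show False by linarith
    qed
  qed
qed

text \<open>
For \<open>a \<le> b\<close> and \<open>k > 0\<close>, a continuously differentiable bump supported in \<open>{a..b}\<close>, built from
the \<open>C\<^sup>1\<close> function \<open>\<lambda>x. (max 0 x)\<^sup>2\<close>. As \<open>k\<close> grows it increases to the indicator of the open
interval. It rises before the midpoint and falls after it, so its derivative tends to the Dirac
mass at \<open>a\<close> minus the Dirac mass at \<open>b\<close>.
\<close>

definition plateau :: "real \<Rightarrow> real \<Rightarrow> real \<Rightarrow> real \<Rightarrow> real" where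
  "plateau k a b x = 1 - (max 0 (1 - k * (max 0 ((x - a) * (b - x)))\<^sup>2))\<^sup>2"

definition plateau' :: "real \<Rightarrow> real \<Rightarrow> real \<Rightarrow> real \<Rightarrow> real" where
  "plateau' k a b x =
     4 * k * max 0 (1 - k * (max 0 ((x - a) * (b - x)))\<^sup>2) * max 0 ((x - a) * (b - x)) * (a + b - 2 * x)"

lemma DERIV_max_zero_squared: "((\<lambda>x::real. (max 0 x)\<^sup>2) has_field_derivative 2 * max 0 x) (at x)"
proof (cases "x = 0")
  case True
  have "((\<lambda>y::real. ((max 0 y)\<^sup>2 - (max 0 0)\<^sup>2) / (y - 0)) \<longlongrightarrow> 0) (at 0)"
  proof (rule Lim_null_comparison)
    show "\<forall>\<^sub>F y in at 0. norm (((max 0 y)\<^sup>2 - (max 0 0)\<^sup>2) / (y - 0)) \<le> \<bar>y::real\<bar>"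
      by (auto simp: max_def power2_eq_square eventually_at_filter intro!: always_eventually)
    show "((\<lambda>y::real. \<bar>y\<bar>) \<longlongrightarrow> 0) (at 0)" by (auto intro!: tendsto_eq_intros)
  qed
  then show ?thesis using True by (simp add: has_field_derivative_iff)
next
  case False
  show ?thesis
  proof (cases "x < 0")
    case True
    have "((\<lambda>x::real. 0) has_field_derivative 0) (at x)" by simp
    then have "((\<lambda>x::real. (max 0 x)\<^sup>2) has_field_derivative 0) (at x)"
      by (rule has_field_derivative_transform_within_open[where S="{..<0}"]) (use True in auto)
    then show ?thesis using True by simp
  next
    case 2: False
    have "((\<lambda>x::real. x\<^sup>2) has_field_derivative 2 * x) (at x)" by (auto intro!: derivative_eq_intros)
    then have "((\<lambda>x::real. (max 0 x)\<^sup>2) has_field_derivative 2 * x) (at x)"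
      by (rule has_field_derivative_transform_within_open[where S="{0<..}"]) (use False 2 in auto)
    then show ?thesis using 2 by simp
  qed
qed

lemmas DERIV_max_zero_squared_chain [derivative_intros] = DERIV_max_zero_squared[THEN DERIV_chain2]

lemma DERIV_plateau: "(plateau k a b has_field_derivative plateau' k a b x) (at x)"
  unfolding plateau_def[abs_def] plateau'_def
  by (auto intro!: derivative_eq_intros simp: algebra_simps)

lemma continuous_on_plateau [continuous_intros]:
  "continuous_on S f \<Longrightarrow> continuous_on S (\<lambda>x. plateau k a b (f x))"
  "continuous_on S f \<Longrightarrow> continuous_on S (\<lambda>x. plateau' k a b (f x))"
  unfolding plateau_def plateau'_def by (auto intro!: continuous_intros)

lemma borel_measurable_plateau [measurable]:
  "plateau k a b \<in> borel_measurable borel" "plateau' k a b \<in> borel_measurable borel"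
  by (intro borel_measurable_continuous_onI continuous_intros)+

lemma plateau_bounds: "0 \<le> k \<Longrightarrow> 0 \<le> plateau k a b x" "plateau k a b x \<le> 1"
  unfolding plateau_def by (auto simp: max_def power_le_one)

lemma plateau_outside: "x \<notin> {a<..<b} \<Longrightarrow> a \<le> b \<Longrightarrow> plateau k a b x = 0 \<and> plateau' k a b x = 0"
proof -
  assume "x \<notin> {a<..<b}" "a \<le> b"
  then have "(x - a) * (b - x) \<le> 0" by (auto simp: mult_le_0_iff)
  then show ?thesis by (simp add: plateau_def plateau'_def max_def)
qed

lemma plateau_flat:
  assumes "0 \<le> \<eta>" "a + \<eta> \<le> x" "x \<le> b - \<eta>" "1 \<le> k * \<eta> ^ 4"
  shows "plateau k a b x = 1" "plateau' k a b x = 0"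
proof -
  have "\<eta>\<^sup>2 \<le> (x - a) * (b - x)" unfolding power2_eq_square using assms by (intro mult_mono) auto
  then have "(\<eta>\<^sup>2)\<^sup>2 \<le> (max 0 ((x - a) * (b - x)))\<^sup>2" by (intro power_mono) auto
  moreover have k: "0 \<le> k"
  proof (rule ccontr)
    assume "\<not> 0 \<le> k"
    then have "k * \<eta> ^ 4 \<le> 0" using assms(1) by (intro mult_nonpos_nonneg) auto
    with assms(4) show False by simp
  qed
  ultimately have "k * (\<eta>\<^sup>2)\<^sup>2 \<le> k * (max 0 ((x - a) * (b - x)))\<^sup>2" by (intro mult_left_mono) auto
  then have "1 - k * (max 0 ((x - a) * (b - x)))\<^sup>2 \<le> 0" using assms(4) by simp
  then show "plateau k a b x = 1" "plateau' k a b x = 0" by (simp_all add: plateau_def plateau'_def max_def)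
qed

lemma plateau'_sign:
  assumes "0 \<le> k"
  shows "x \<le> (a + b) / 2 \<Longrightarrow> 0 \<le> plateau' k a b x" "(a + b) / 2 \<le> x \<Longrightarrow> plateau' k a b x \<le> 0"
proof -
  let ?c = "4 * k * max 0 (1 - k * (max 0 ((x - a) * (b - x)))\<^sup>2) * max 0 ((x - a) * (b - x))"
  have c: "0 \<le> ?c" using assms by simp
  show "0 \<le> plateau' k a b x" if "x \<le> (a + b) / 2"
    unfolding plateau'_def using that by (intro mult_nonneg_nonneg[OF c]) auto
  show "plateau' k a b x \<le> 0" if "(a + b) / 2 \<le> x"
    unfolding plateau'_def using that by (intro mult_nonneg_nonpos[OF c]) auto
qed

lemma C1_compact_support_plateau_product:
  assumes "a \<le> b" "c \<le> e" "{a..b} \<times> {c..e} \<subseteq> \<Omega>"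
  shows "C1_compact_support \<Omega> (\<lambda>p. plateau k a b (fst p) * plateau l c e (snd p))"
  unfolding C1_compact_support_def
proof (intro conjI exI allI impI)
  let ?D = "\<lambda>p. (plateau' k a b (fst p) * plateau l c e (snd p)) *\<^sub>R (fst_blinfun :: (real \<times> real) \<Rightarrow>\<^sub>L real)
    + (plateau k a b (fst p) * plateau' l c e (snd p)) *\<^sub>R (snd_blinfun :: (real \<times> real) \<Rightarrow>\<^sub>L real)"
  show "continuous_on UNIV ?D" by (intro continuous_intros)
  fix p :: "real \<times> real"
  have 1: "((\<lambda>p. plateau k a b (fst p)) has_derivative (\<lambda>h. plateau' k a b (fst p) * fst h)) (at p)"
    by (rule has_derivative_compose[of fst fst p UNIV "plateau k a b", OF _ DERIV_plateau[of k a b "fst p", unfolded has_field_derivative_def]])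
      (auto intro: derivative_intros)
  have 2: "((\<lambda>p. plateau l c e (snd p)) has_derivative (\<lambda>h. plateau' l c e (snd p) * snd h)) (at p)"
    by (rule has_derivative_compose[of snd snd p UNIV "plateau l c e", OF _ DERIV_plateau[of l c e "snd p", unfolded has_field_derivative_def]])
      (auto intro: derivative_intros)
  show "((\<lambda>p. plateau k a b (fst p) * plateau l c e (snd p)) has_derivative blinfun_apply (?D p)) (at p)"
    by (rule has_derivative_eq_rhs[OF has_derivative_mult[OF 1 2]])
      (auto simp: blinfun.add_left blinfun.scaleR_left fun_eq_iff algebra_simps snd_blinfun.rep_eq)
next
  show "compact ({a..b} \<times> {c..e})" by (intro compact_Times) auto
  show "{a..b} \<times> {c..e} \<subseteq> \<Omega>" by fact
  fix p assume "p \<notin> {a..b} \<times> {c..e}"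
  then have "fst p \<notin> {a<..<b} \<or> snd p \<notin> {c<..<e}" by (cases p) auto
  then show "plateau k a b (fst p) * plateau l c e (snd p) = 0"
    using plateau_outside assms by fastforce
qed

text \<open>
For large \<open>k\<close> the derivative of the plateau is concentrated near \<open>a\<close>, where it is nonnegative
with integral \<open>1\<close>, and near \<open>b\<close>, where it is nonpositive with integral \<open>- 1\<close>. Continuity of \<open>f\<close>
then makes the integral close to \<open>f a - f b\<close>.
\<close>

lemma difference_le_if_plateau_integrals_le:
  fixes f :: "real \<Rightarrow> real"
  assumes ab: "a < b" and f: "continuous_on {a..b} f"
    and le: "\<And>k::nat. \<bar>integral {a..b} (\<lambda>x. f x * plateau' k a b x)\<bar> \<le> M"
  shows "\<bar>f b - f a\<bar> \<le> M"
proof (rule field_le_epsilon)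
  fix \<epsilon> :: real assume "0 < \<epsilon>"
  define e where "e = \<epsilon> / 2"
  have e: "0 < e" using \<open>0 < \<epsilon>\<close> by (simp add: e_def)
  obtain da where da: "0 < da" "\<And>x. x \<in> {a..b} \<Longrightarrow> \<bar>x - a\<bar> < da \<Longrightarrow> \<bar>f x - f a\<bar> \<le> e"
    using f[unfolded continuous_on_iff, rule_format, of a e] ab e by (force simp: dist_real_def)
  obtain db where db: "0 < db" "\<And>x. x \<in> {a..b} \<Longrightarrow> \<bar>x - b\<bar> < db \<Longrightarrow> \<bar>f x - f b\<bar> \<le> e"
    using f[unfolded continuous_on_iff, rule_format, of b e] ab e by (force simp: dist_real_def)
  define \<eta> where "\<eta> = Min {da / 2, db / 2, (b - a) / 2}"
  have \<eta>: "0 < \<eta>" "\<eta> < da" "\<eta> < db" "\<eta> \<le> (b - a) / 2"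
    using da db ab by (auto simp: \<eta>_def min_def)
  obtain k :: nat where "1 / \<eta> ^ 4 \<le> k" using real_arch_simple by blast
  then have k: "1 \<le> k * \<eta> ^ 4" using \<eta>(1) by (simp add: divide_le_eq)
  define mid where "mid = (a + b) / 2"
  have mid: "a \<le> mid" "mid \<le> b" "\<eta> \<le> mid - a" "\<eta> \<le> b - mid" using ab \<eta>(4) by (auto simp: mid_def field_simps)
  let ?p = "plateau k a b" and ?p' = "plateau' k a b"
  have pmid: "?p mid = 1" using mid \<eta> k by (intro plateau_flat[where \<eta>=\<eta>]) auto
  have ftc: "(?p' has_integral ?p v - ?p u) {u..v}" if "u \<le> v" for u v
    using that DERIV_plateau by (intro fundamental_theorem_of_calculus)
      (auto simp: has_real_derivative_iff_has_vector_derivative[symmetric] intro: has_field_derivative_at_within)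
  have I1: "integral {a..mid} ?p' = 1" using ftc[of a mid] mid pmid plateau_outside[of a a b k] ab by (simp add: integral_unique)
  have I2: "integral {mid..b} ?p' = -1" using ftc[of mid b] mid pmid plateau_outside[of b a b k] ab by (simp add: integral_unique)
  have ic: "g integrable_on {u..v}" if "continuous_on {a..b} g" "a \<le> u" "v \<le> b" for g :: "real \<Rightarrow> real" and u v
    using that by (intro integrable_continuous_real) (auto intro: continuous_on_subset)
  have fc: "continuous_on {a..b} (\<lambda>x. f x * ?p' x)" by (intro continuous_intros f)
  have pc: "continuous_on {a..b} (\<lambda>x. (f a + c) * ?p' x)" "continuous_on {a..b} (\<lambda>x. (f b + c) * ?p' x)" for c by (intro continuous_intros)+
  have L: "\<bar>f x * ?p' x - f a * ?p' x\<bar> \<le> e * ?p' x" if "x \<in> {a..mid}" for x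
  proof (cases "x < a + \<eta>")
    case True
    then have "\<bar>f x - f a\<bar> \<le> e" using that mid \<eta> by (intro da) auto
    moreover have "0 \<le> ?p' x" using that by (intro plateau'_sign) (auto simp: mid_def)
    ultimately have "\<bar>f x - f a\<bar> * \<bar>?p' x\<bar> \<le> e * ?p' x" by (auto intro: mult_right_mono)
    then show ?thesis by (simp flip: abs_mult add: algebra_simps)
  next
    case False
    then have "?p' x = 0" using that mid \<eta> k by (intro plateau_flat[where \<eta>=\<eta>]) auto
    then show ?thesis by simp
  qed
  have R: "\<bar>f x * ?p' x - f b * ?p' x\<bar> \<le> e * - ?p' x" if "x \<in> {mid..b}" for x
  proof (cases "b - \<eta> < x")
    case True
    then have "\<bar>f x - f b\<bar> \<le> e" using that mid \<eta> by (intro db) auto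
    moreover have "?p' x \<le> 0" using that by (intro plateau'_sign) (auto simp: mid_def)
    ultimately have "\<bar>f x - f b\<bar> * \<bar>?p' x\<bar> \<le> e * - ?p' x" by (auto intro: mult_right_mono_neg)
    then show ?thesis by (simp flip: abs_mult add: algebra_simps)
  next
    case False
    then have "?p' x = 0" using that mid \<eta> k by (intro plateau_flat[where \<eta>=\<eta>]) auto
    then show ?thesis by simp
  qed
  have "\<bar>integral {a..mid} (\<lambda>x. f x * ?p' x) - f a\<bar> \<le> e"
  proof -
    have "integral {a..mid} (\<lambda>x. f x * ?p' x) - f a = integral {a..mid} (\<lambda>x. f x * ?p' x - f a * ?p' x)"
      using I1 mid ic[OF fc] ic[OF pc(1)[of 0]] by (subst Henstock_Kurzweil_Integration.integral_diff) auto
    also have "\<bar>\<dots>\<bar> \<le> integral {a..mid} (\<lambda>x. e * ?p' x)"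
      unfolding real_norm_def[symmetric]
      by (rule integral_norm_bound_integral)
        (use L mid in \<open>auto intro!: ic continuous_intros f\<close>)
    finally show ?thesis using I1 by simp
  qed
  moreover have "\<bar>integral {mid..b} (\<lambda>x. f x * ?p' x) + f b\<bar> \<le> e"
  proof -
    have "integral {mid..b} (\<lambda>x. f x * ?p' x) + f b = integral {mid..b} (\<lambda>x. f x * ?p' x - f b * ?p' x)"
      using I2 mid ic[OF fc] ic[OF pc(2)[of 0]] by (subst Henstock_Kurzweil_Integration.integral_diff) auto
    also have "\<bar>\<dots>\<bar> \<le> integral {mid..b} (\<lambda>x. e * - ?p' x)"
      unfolding real_norm_def[symmetric]
      by (rule integral_norm_bound_integral)
        (use R mid in \<open>auto intro!: ic continuous_intros f\<close>)
    finally show ?thesis using I2 by simp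
  qed
  moreover have "integral {a..b} (\<lambda>x. f x * ?p' x) =
      integral {a..mid} (\<lambda>x. f x * ?p' x) + integral {mid..b} (\<lambda>x. f x * ?p' x)"
    using mid ic[OF fc] by (simp add: Henstock_Kurzweil_Integration.integral_combine)
  ultimately show "\<bar>f b - f a\<bar> \<le> M + \<epsilon>" using le[of k] unfolding e_def by linarith
qed

lemma continuous_lipschitz_if_rational_lipschitz:
  fixes f :: "real \<Rightarrow> real"
  assumes f: "continuous_on {0..R} f" and R: "0 < R" and C: "0 \<le> C"
    and le: "\<And>a b. a \<in> \<rat> \<Longrightarrow> b \<in> \<rat> \<Longrightarrow> 0 < a \<Longrightarrow> a < b \<Longrightarrow> b < R \<Longrightarrow> \<bar>f b - f a\<bar> \<le> C * (b - a)"
    and x: "x \<in> {0..R}" and y: "y \<in> {0..R}"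
  shows "\<bar>f x - f y\<bar> \<le> C * \<bar>x - y\<bar>"
proof (rule field_le_epsilon)
  fix \<epsilon> :: real assume \<epsilon>: "0 < \<epsilon>"
  define e where "e = \<epsilon> / (2 + 2 * C)"
  have e: "0 < e" using \<epsilon> C by (simp add: e_def)
  have near: "\<exists>a\<in>\<rat>. 0 < a \<and> a < R \<and> \<bar>a - x\<bar> \<le> e \<and> \<bar>f a - f x\<bar> \<le> e" if x: "x \<in> {0..R}" for x
  proof -
    obtain d where d: "0 < d" "\<And>y. y \<in> {0..R} \<Longrightarrow> \<bar>y - x\<bar> < d \<Longrightarrow> \<bar>f y - f x\<bar> < e"
      using f[unfolded continuous_on_iff, rule_format, OF x e] by (auto simp: dist_real_def)
    have "max 0 (x - min d e) < min R (x + min d e)" using x R d e by auto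
    then obtain a where "a \<in> \<rat>" "max 0 (x - min d e) < a" "a < min R (x + min d e)"
      using Rats_dense_in_real by blast
    moreover from this have "\<bar>a - x\<bar> < d" "\<bar>a - x\<bar> < e" by (auto simp: abs_less_iff)
    ultimately show ?thesis using d(2)[of a] by (intro bexI[of _ a]) auto
  qed
  obtain a where a: "a \<in> \<rat>" "0 < a" "a < R" "\<bar>a - x\<bar> \<le> e" "\<bar>f a - f x\<bar> \<le> e" using near[OF x] by blast
  obtain b where b: "b \<in> \<rat>" "0 < b" "b < R" "\<bar>b - y\<bar> \<le> e" "\<bar>f b - f y\<bar> \<le> e" using near[OF y] by blast
  have "\<bar>f a - f b\<bar> \<le> C * \<bar>a - b\<bar>"
    using le[of a b] le[of b a] a b by (cases a b rule: linorder_cases) (auto simp: abs_minus_commute)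
  also have "\<dots> \<le> C * (\<bar>x - y\<bar> + 2 * e)" using a b C by (intro mult_left_mono) linarith+
  finally have "\<bar>f x - f y\<bar> \<le> C * \<bar>x - y\<bar> + e * (2 + 2 * C)"
    using a b by (simp add: algebra_simps)
  then show "\<bar>f x - f y\<bar> \<le> C * \<bar>x - y\<bar> + \<epsilon>" using C by (simp add: e_def)
qed

text \<open>
Testing the weak derivative with plateaus in both variables bounds the average over every
interval of ages \<open>x\<close> of the slice integrals; \<open>AE_nonneg_if_interval_integrals_nonneg\<close> makes the
bound pointwise. The plateau in \<open>y\<close> stays fixed here because its sharpening needs continuity of
the slice, which is used for one \<open>x\<close> at a time.
\<close>

lemma AE_slice_integral_le_if_weak_deriv_le:
  fixes r :: "real \<Rightarrow> real \<Rightarrow> real" and k :: nat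
  assumes wd: "weak_deriv_snd \<Omega> r g"
    and g: "AE z in lebesgue_on \<Omega>. \<bar>g z\<bar> \<le> \<gamma>" and \<gamma>: "0 \<le> \<gamma>"
    and \<Omega>: "open \<Omega>" "{p..q} \<times> {a..b} \<subseteq> \<Omega>" and ab: "a \<le> b" and pq: "p \<le> q"
    and bound: "\<And>x y. x \<in> {p..q} \<Longrightarrow> y \<in> {a..b} \<Longrightarrow> \<bar>r x y\<bar> \<le> K"
    and cont: "AE x in lborel. x \<in> {p..q} \<longrightarrow> continuous_on {a..b} (r x)"
  shows "AE x in lborel. x \<in> {p..q} \<longrightarrow>
           \<bar>integral {a..b} (\<lambda>y. r x y * plateau' k a b y)\<bar> \<le> \<gamma> * (b - a)"
proof -
  let ?S = "{p..q} \<times> {a..b}"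
  have K: "0 \<le> K" using bound[of p a] ab pq by force
  define rS where "rS = (\<lambda>z. indicator ?S z * r (fst z) (snd z))"
  have rS_int: "integrable lebesgue rS"
  proof -
    have "compact ?S" by (intro compact_Times) auto
    then have "set_integrable lebesgue ?S (\<lambda>(x, y). r x y)"
      using wd \<Omega>(2) by (auto simp: weak_deriv_snd_def L1_loc_def)
    then show ?thesis by (simp add: set_integrable_def rS_def case_prod_unfold)
  qed
  then have rS_meas [measurable]: "rS \<in> borel_measurable lebesgue" by simp
  obtain h0 where h0: "h0 \<in> borel_measurable lborel" "AE z in lborel. rS z = h0 z"
    using completion_ex_borel_measurable_real[OF rS_meas] by blast
  \<comment> \<open>truncation of the Borel representative makes all slice integrals finite\<close>
  define h where "h = (\<lambda>z. max (- K) (min K (h0 z)))"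
  have h_meas [measurable]: "h \<in> borel_measurable borel" using h0(1) unfolding h_def by auto
  have h_bound: "\<bar>h z\<bar> \<le> K" for z unfolding h_def using K by auto
  have h_eq: "AE z in lborel. rS z = h z"
    using h0(2)
  proof eventually_elim
    case (elim z)
    have "\<bar>rS z\<bar> \<le> K" unfolding rS_def using bound[of "fst z" "snd z"] K by (cases z) (auto simp: indicator_def)
    then show ?case using elim by (auto simp: h_def)
  qed
  define w where "w = (\<lambda>y. indicator {a..b} y * plateau' k a b y)"
  have w_meas [measurable]: "w \<in> borel_measurable borel" unfolding w_def by measurable
  have "compact (plateau' k a b ` {a..b})" by (intro compact_continuous_image continuous_intros) auto
  then obtain C0 where C0: "\<And>y. y \<in> {a..b} \<Longrightarrow> \<bar>plateau' k a b y\<bar> \<le> C0"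
    using compact_imp_bounded[THEN bounded_iff[THEN iffD1]] by (metis imageI real_norm_def)
  define C where "C = max 0 C0"
  have w_bound: "\<bar>w y\<bar> \<le> C * indicator {a..b} y" for y
    using C0[of y] by (auto simp: w_def C_def indicator_def)
  have C: "0 \<le> C" by (simp add: C_def)
  define F where "F = (\<lambda>x. LBINT y. h (x, y) * w y)"
  have F_meas [measurable]: "F \<in> borel_measurable borel"
    unfolding F_def by measurable
  have F_bound: "\<bar>F x\<bar> \<le> K * C * (b - a)" for x
  proof -
    have "norm (F x) \<le> (LBINT y. norm (h (x, y) * w y))"
      unfolding F_def by (rule integral_norm_bound)
    also have "\<dots> \<le> (LBINT y. K * C * indicator {a..b} y)"
    proof (rule integral_mono')
      show "integrable lborel (\<lambda>y. K * C * indicator {a..b} y)"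
        using ab by (intro integrable_mult_right integrable_real_indicator) auto
      show "norm (h (x, y) * w y) \<le> K * C * indicator {a..b} y" for y
        using h_bound w_bound K by (auto simp: abs_mult mult.assoc intro!: mult_mono)
      show "0 \<le> K * C * indicator {a..b} y" for y
        using K C by simp
    qed
    finally have "norm (F x) \<le> (LBINT y. K * C * indicator {a..b} y)" .
    then show ?thesis using ab by simp
  qed
  have avg: "\<bar>LBINT x:{u<..v}. F x\<bar> \<le> \<gamma> * (b - a) * (v - u)" if uv: "p \<le> u" "u \<le> v" "v \<le> q" for u v
  proof -
    define \<alpha> where "\<alpha> n = plateau (real n) u v" for n
    have \<alpha>_meas [measurable]: "\<alpha> n \<in> borel_measurable borel" for n
      unfolding \<alpha>_def by measurable
    have \<alpha>_bound: "0 \<le> \<alpha> n x" "\<alpha> n x \<le> indicator {u<..v} x" "\<alpha> n x \<le> 1" for n x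
      using plateau_bounds[of n u v x] plateau_outside[of x u v n] uv by (auto simp: \<alpha>_def indicator_def)
    have \<alpha>_zero: "\<alpha> n x = 0" if "x \<notin> {u<..<v}" for n x
      using plateau_outside[OF that] uv by (simp add: \<alpha>_def)
    have test: "\<bar>LBINT x. \<alpha> n x * F x\<bar> \<le> \<gamma> * (b - a) * (v - u)" for n :: nat
    proof -
      define \<phi> where "\<phi> = (\<lambda>z. \<alpha> n (fst z) * plateau k a b (snd z))"
      have sub: "{u..v} \<times> {a..b} \<subseteq> \<Omega>" using \<Omega>(2) uv by force
      have \<phi>: "C1_compact_support \<Omega> \<phi>"
        unfolding \<phi>_def \<alpha>_def using uv ab sub by (intro C1_compact_support_plateau_product) auto
      have deriv: "deriv (\<lambda>J. \<phi> (fst z, J)) (snd z) = \<alpha> n (fst z) * plateau' k a b (snd z)" for z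
        unfolding \<phi>_def by (auto intro!: DERIV_imp_deriv DERIV_cmult DERIV_plateau)
      have m: "(\<lambda>z. \<alpha> n (fst z) * w (snd z)) \<in> borel_measurable (lborel :: (real \<times> real) measure)"
        unfolding lborel_prod[symmetric] by measurable
      have hm: "(\<lambda>z. h z * (\<alpha> n (fst z) * w (snd z))) \<in> borel_measurable lborel"
        using h_meas by (intro borel_measurable_times m) simp
      have int2: "integrable (lborel \<Otimes>\<^sub>M lborel) (\<lambda>z. h z * (\<alpha> n (fst z) * w (snd z)))"
        unfolding lborel_prod
      proof (rule Bochner_Integration.integrable_bound)
        show "integrable lborel (\<lambda>z. K * C * indicator ({u..v} \<times> {a..b}) z :: real)"
          by (intro integrable_mult_right integrable_real_indicator emeasure_compact_finite compact_Times)
            (auto intro!: borel_closed closed_Times)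
        show "AE z in lborel. norm (h z * (\<alpha> n (fst z) * w (snd z))) \<le> norm (K * C * indicator ({u..v} \<times> {a..b}) z :: real)"
        proof (intro AE_I2)
          fix z :: "real \<times> real"
          have "\<bar>\<alpha> n (fst z)\<bar> \<le> indicator {u..v} (fst z)"
            using \<alpha>_bound[of n "fst z"] by (auto simp: indicator_def split: if_splits)
          then have "\<bar>\<alpha> n (fst z)\<bar> * \<bar>w (snd z)\<bar> \<le> indicator {u..v} (fst z) * (C * indicator {a..b} (snd z))"
            using w_bound by (intro mult_mono) auto
          then have "\<bar>h z\<bar> * (\<bar>\<alpha> n (fst z)\<bar> * \<bar>w (snd z)\<bar>) \<le> K * (indicator {u..v} (fst z) * (C * indicator {a..b} (snd z)))"
            using K by (intro mult_mono[OF h_bound]) auto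
          then show "norm (h z * (\<alpha> n (fst z) * w (snd z))) \<le> norm (K * C * indicator ({u..v} \<times> {a..b}) z :: real)"
            using K C by (cases z) (auto simp: abs_mult indicator_def split: if_splits)
        qed
      qed (rule hm)
      have "(LBINT x. \<alpha> n x * F x) = (LBINT x. (LBINT y. h (x, y) * (\<alpha> n x * w y)))"
        unfolding F_def by (simp add: mult.left_commute)
      also have "\<dots> = integral\<^sup>L (lborel \<Otimes>\<^sub>M lborel) (\<lambda>z. h z * (\<alpha> n (fst z) * w (snd z)))"
        using lborel_pair.integral_fst'[OF int2] by simp
      also have "\<dots> = integral\<^sup>L lebesgue (\<lambda>z. h z * (\<alpha> n (fst z) * w (snd z)))"
        unfolding lborel_prod by (rule integral_completion[symmetric, OF hm])
      also have "\<dots> = (LINT z:\<Omega>|lebesgue. r (fst z) (snd z) * deriv (\<lambda>J. \<phi> (fst z, J)) (snd z))"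
        unfolding set_lebesgue_integral_def deriv
      proof (rule integral_cong_AE)
        have eq: "indicator \<Omega> z *\<^sub>R (r (fst z) (snd z) * (\<alpha> n (fst z) * plateau' k a b (snd z)))
          = rS z * (\<alpha> n (fst z) * w (snd z))" for z
        proof (cases "z \<in> {u..v} \<times> {a..b}")
          case True
          then have "z \<in> \<Omega>" "z \<in> ?S" "snd z \<in> {a..b}" using sub uv by (cases z; force)+
          then show ?thesis by (simp add: rS_def w_def)
        next
          case False
          then consider "\<alpha> n (fst z) = 0" | "snd z \<notin> {a..b}"
            using \<alpha>_zero[of "fst z" n] by (cases z) force
          then show ?thesis
          proof cases
            case 2
            then have "plateau' k a b (snd z) = 0" using plateau_outside[of "snd z" a b k] ab by auto
            then show ?thesis by (simp add: w_def)
          qed simp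
        qed
        show "(\<lambda>z. indicator \<Omega> z *\<^sub>R (r (fst z) (snd z) * (\<alpha> n (fst z) * plateau' k a b (snd z)))) \<in> borel_measurable lebesgue"
          unfolding eq by (intro borel_measurable_times rS_meas measurable_completion m)
        show "(\<lambda>z. h z * (\<alpha> n (fst z) * w (snd z))) \<in> borel_measurable lebesgue"
          by (intro measurable_completion hm)
        show "AE z in lebesgue. h z * (\<alpha> n (fst z) * w (snd z)) =
            indicator \<Omega> z *\<^sub>R (r (fst z) (snd z) * (\<alpha> n (fst z) * plateau' k a b (snd z)))"
          unfolding eq using AE_completion[OF h_eq] by eventually_elim simp
      qed
      also have "\<dots> = - (LINT z:\<Omega>|lebesgue. g z * \<phi> z)"
        using wd \<phi> by (auto simp: weak_deriv_snd_def)
      finally have "\<bar>LBINT x. \<alpha> n x * F x\<bar> = \<bar>LINT z:\<Omega>|lebesgue. g z * \<phi> z\<bar>" by simp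
      also have "\<dots> \<le> (LINT z|lebesgue. norm (indicator \<Omega> z *\<^sub>R (g z * \<phi> z)))"
        unfolding set_lebesgue_integral_def real_norm_def[symmetric] by (rule integral_norm_bound)
      also have "\<dots> \<le> (LINT z|lebesgue. \<gamma> * indicator ({u..v} \<times> {a..b}) z)"
      proof (rule integral_mono_AE')
        show "integrable lebesgue (\<lambda>z::real \<times> real. \<gamma> * indicator ({u..v} \<times> {a..b}) z)"
          by (intro integrable_mult_right integrable_real_indicator)
            (auto intro!: lmeasurable_compact[THEN fmeasurableD] lmeasurable_compact[THEN fmeasurableD2, THEN less_top[THEN iffD1]] compact_Times)
        have "AE z in lebesgue. z \<in> \<Omega> \<longrightarrow> \<bar>g z\<bar> \<le> \<gamma>"
          using g \<Omega>(1) by (subst (asm) AE_restrict_space_iff) auto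
        then show "AE z in lebesgue. norm (indicator \<Omega> z *\<^sub>R (g z * \<phi> z)) \<le> \<gamma> * indicator ({u..v} \<times> {a..b}) z"
        proof eventually_elim
          case (elim z)
          have "\<bar>\<phi> z\<bar> \<le> indicator ({u..v} \<times> {a..b}) z"
          proof (cases "z \<in> {u..v} \<times> {a..b}")
            case True
            have "\<bar>\<phi> z\<bar> \<le> 1"
              unfolding \<phi>_def using \<alpha>_bound[of n "fst z"] plateau_bounds[of k a b "snd z"]
              by (auto simp: abs_mult indicator_def intro!: mult_le_one split: if_splits)
            then show ?thesis using True by simp
          next
            case False
            then have "\<phi> z = 0"
              using plateau_outside[of "snd z" a b k] \<alpha>_zero[of "fst z" n] ab
              by (cases z) (force simp: \<phi>_def)
            then show ?thesis by simp
          qed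
          then have "z \<in> \<Omega> \<Longrightarrow> \<bar>g z\<bar> * \<bar>\<phi> z\<bar> \<le> \<gamma> * indicator ({u..v} \<times> {a..b}) z"
            using elim \<gamma> by (intro mult_mono) auto
          then show ?case using \<gamma> by (cases "z \<in> \<Omega>") (auto simp: abs_mult)
        qed
      qed (use \<gamma> in auto)
      also have "\<dots> = \<gamma> * ((v - u) * (b - a))"
      proof -
        have "measure lebesgue ({u..v} \<times> {a..b}) = (v - u) * (b - a)"
        proof -
          have "{u..v} \<times> {a..b} = cbox (u, a) (v, b)" by (simp add: cbox_Pair_eq)
          then have "measure lebesgue ({u..v} \<times> {a..b}) = measure lborel (cbox (u, a) (v, b))" by simp
          then show ?thesis unfolding content_Pair using uv ab by simp
        qed
        then show ?thesis by simp
      qed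
      finally show ?thesis by (simp add: mult.commute mult.left_commute)
    qed
    have "(\<lambda>n. LBINT x. \<alpha> n x * F x) \<longlonglongrightarrow> (LBINT x. indicator {u<..<v} x * F x)"
    proof (rule integral_dominated_convergence)
      show "integrable lborel (\<lambda>x. K * C * (b - a) * indicator {u<..v} x :: real)" using uv by simp
      show "AE x in lborel. norm (\<alpha> n x * F x) \<le> K * C * (b - a) * indicator {u<..v} x" for n
      proof (intro AE_I2)
        fix x
        have "\<bar>\<alpha> n x\<bar> * \<bar>F x\<bar> \<le> indicator {u<..v} x * (K * C * (b - a))"
          using \<alpha>_bound[of n x] by (intro mult_mono F_bound) auto
        then show "norm (\<alpha> n x * F x) \<le> K * C * (b - a) * indicator {u<..v} x"
          by (simp add: abs_mult mult.commute)
      qed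
      show "AE x in lborel. (\<lambda>n. \<alpha> n x * F x) \<longlonglongrightarrow> indicator {u<..<v} x * F x"
      proof (intro AE_I2 tendsto_mult tendsto_const)
        fix x
        show "(\<lambda>n. \<alpha> n x) \<longlonglongrightarrow> indicator {u<..<v} x"
        proof (cases "x \<in> {u<..<v}")
          case True
          define \<eta> where "\<eta> = min (x - u) (v - x)"
          have \<eta>: "0 < \<eta>" "u + \<eta> \<le> x" "x \<le> v - \<eta>" using True by (auto simp: \<eta>_def)
          obtain N :: nat where N: "1 / \<eta> ^ 4 \<le> N" using real_arch_simple by blast
          have "\<alpha> n x = 1" if "N \<le> n" for n
          proof -
            have "1 / \<eta> ^ 4 \<le> real n" using N that by linarith
            then have "1 \<le> n * \<eta> ^ 4" using \<eta>(1) by (simp add: divide_le_eq)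
            then show ?thesis unfolding \<alpha>_def using \<eta> by (intro plateau_flat[where \<eta>=\<eta>]) auto
          qed
          then show ?thesis using True by (auto intro!: tendsto_eventually eventually_sequentiallyI[of N])
        qed (use plateau_outside[of x u v] uv in \<open>simp add: \<alpha>_def\<close>)
      qed
    qed measurable
    then have "\<bar>LBINT x. indicator {u<..<v} x * F x\<bar> \<le> \<gamma> * (b - a) * (v - u)"
      using test by (intro tendsto_upperbound[OF tendsto_rabs]) auto
    also have "(LBINT x. indicator {u<..<v} x * F x) = (LBINT x:{u<..v}. F x)"
      unfolding set_lebesgue_integral_def
      by (rule integral_cong_AE) (auto simp: indicator_def intro!: eventually_mono[OF AE_lborel_singleton[of v]])
    finally show ?thesis .
  qed
  have nonneg: "AE x in lborel. x \<in> {p..q} \<longrightarrow> 0 \<le> \<gamma> * (b - a) + c * F x" if c: "c = 1 \<or> c = - 1" for c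
  proof (rule AE_nonneg_if_interval_integrals_nonneg)
    have "0 \<le> \<gamma> * (b - a)" using \<gamma> ab by simp
    then show "\<bar>\<gamma> * (b - a) + c * F x\<bar> \<le> \<gamma> * (b - a) + K * C * (b - a)" for x
      using F_bound[of x] c by auto
    fix u v assume uv: "p \<le> u" "u \<le> v" "v \<le> q"
    have 1: "set_integrable lborel {u<..v} F"
      by (rule set_integrable_bounded_Icc[where a=u and b=v and K="K * C * (b - a)"]) (use F_bound in auto)
    have 2: "set_integrable lborel {u<..v} (\<lambda>_. \<gamma> * (b - a))"
      by (rule set_integrable_bounded_Icc[where a=u and b=v and K="\<gamma> * (b - a)"]) (use \<gamma> ab in auto)
    have "(LBINT x:{u<..v}. \<gamma> * (b - a) + c * F x) = (LBINT x:{u<..v}. \<gamma> * (b - a)) + c * (LBINT x:{u<..v}. F x)"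
      using 1 2 by (simp add: set_integral_add)
    also have "(LBINT x:{u<..v}. \<gamma> * (b - a)) = \<gamma> * (b - a) * (v - u)"
      using uv by (subst set_integral_const) auto
    finally show "0 \<le> (LBINT x:{u<..v}. \<gamma> * (b - a) + c * F x)"
      using avg[OF uv] c by auto
  qed measurable
  have slices: "AE x in lborel. AE y in lborel. rS (x, y) = h (x, y)"
    using h_eq unfolding lborel_prod[symmetric] by (rule lborel_pair.AE_pair)
  show ?thesis
    using nonneg[of 1, OF disjI1[OF refl]] nonneg[of "-1", OF disjI2[OF refl]] slices cont
  proof eventually_elim
    case (elim x)
    show ?case
    proof
      assume x: "x \<in> {p..q}"
      have c: "continuous_on {a..b} (\<lambda>y. r x y * plateau' k a b y)"
        using elim x by (intro continuous_intros) auto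
      have si: "set_integrable lborel {a..b} (\<lambda>y. r x y * plateau' k a b y)"
        using borel_integrable_atLeastAtMost'[OF c] .
      have "integral {a..b} (\<lambda>y. r x y * plateau' k a b y) = (LBINT y:{a..b}. r x y * plateau' k a b y)"
        using set_borel_integral_eq_integral(2)[OF si] by simp
      also have "\<dots> = F x"
        unfolding F_def set_lebesgue_integral_def
      proof (rule integral_cong_AE)
        show "AE y in lborel. indicator {a..b} y *\<^sub>R (r x y * plateau' k a b y) = h (x, y) * w y"
          using elim(3)
        proof eventually_elim
          case (elim y)
          then show ?case using x by (auto simp: rS_def w_def indicator_def)
        qed
        show "(\<lambda>y. indicator {a..b} y *\<^sub>R (r x y * plateau' k a b y)) \<in> borel_measurable lborel"
          using si unfolding set_integrable_def by (rule borel_measurable_integrable)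
      qed measurable
      finally show "\<bar>integral {a..b} (\<lambda>y. r x y * plateau' k a b y)\<bar> \<le> \<gamma> * (b - a)"
        using elim x by auto
    qed
  qed
qed

text \<open>
Only countably many exceptional null sets arise: rational end points \<open>a < b\<close>, integer sharpness
\<open>k\<close>, and the age intervals \<open>{inverse (Suc m)..Suc m}\<close> that exhaust the half line. Continuity of
\<open>r x\<close> then extends the bound to all pairs, end points included.
\<close>

theorem AE_lipschitz_if_weak_deriv_bounded:
  fixes r :: "real \<Rightarrow> real \<Rightarrow> real"
  assumes wd: "weak_deriv_snd ({0<..} \<times> {0<..<R}) r g"
    and g: "AE z in lebesgue_on ({0<..} \<times> {0<..<R}). \<bar>g z\<bar> \<le> \<gamma>" and \<gamma>: "0 \<le> \<gamma>" and R: "0 < R"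
    and bound: "\<And>x y. 0 < x \<Longrightarrow> y \<in> {0..R} \<Longrightarrow> \<bar>r x y\<bar> \<le> K"
    and cont: "AE x in lebesgue. 0 < x \<longrightarrow> continuous_on {0..R} (r x)"
  shows "AE x in lborel. 0 < x \<longrightarrow> (\<forall>y\<in>{0..R}. \<forall>z\<in>{0..R}. \<bar>r x y - r x z\<bar> \<le> \<gamma> * \<bar>y - z\<bar>)"
proof -
  let ?P = "{(a, b). a \<in> \<rat> \<and> b \<in> \<rat> \<and> 0 < a \<and> a < b \<and> b < R}"
  have cont': "AE x in lborel. 0 < x \<longrightarrow> continuous_on {0..R} (r x)"
    using cont by (simp add: AE_completion_iff)
  have "AE x in lborel. \<forall>ab\<in>?P. \<forall>k::nat. \<forall>m::nat. x \<in> {inverse (Suc m)..Suc m} \<longrightarrow>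
    \<bar>integral {fst ab..snd ab} (\<lambda>y. r x y * plateau' k (fst ab) (snd ab) y)\<bar> \<le> \<gamma> * (snd ab - fst ab)"
    (is "AE x in lborel. \<forall>ab\<in>?P. \<forall>k m. ?Q x ab k m")
  proof (subst AE_ball_countable, safe)
    show "countable ?P"
      by (rule countable_subset[of _ "\<rat> \<times> \<rat>"]) (auto intro: countable_rat)
    fix a b assume ab: "a \<in> \<rat>" "b \<in> \<rat>" "0 < a" "a < b" "b < R"
    show "AE x in lborel. \<forall>k m. ?Q x (a, b) k m"
      unfolding AE_all_countable fst_conv snd_conv
    proof (intro allI)
      fix k m :: nat
      show "AE x in lborel. x \<in> {inverse (real (Suc m))..real (Suc m)} \<longrightarrow>
        \<bar>integral {a..b} (\<lambda>y. r x y * plateau' k a b y)\<bar> \<le> \<gamma> * (b - a)"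
      proof (rule AE_slice_integral_le_if_weak_deriv_le[OF wd g \<gamma>])
        show "open ({0::real<..} \<times> {0<..<R})" by (intro open_Times) auto
        have m: "0 < inverse (real (Suc m))" by simp
        show "{inverse (real (Suc m))..real (Suc m)} \<times> {a..b} \<subseteq> {0<..} \<times> {0<..<R}"
          using ab m by (auto intro: less_le_trans[OF m])
        show "inverse (real (Suc m)) \<le> real (Suc m)" by (simp add: field_simps)
        show "\<bar>r x y\<bar> \<le> K" if "x \<in> {inverse (real (Suc m))..real (Suc m)}" "y \<in> {a..b}" for x y
          using that ab by (intro bound) (auto intro: less_le_trans[OF m])
        show "AE x in lborel. x \<in> {inverse (real (Suc m))..real (Suc m)} \<longrightarrow> continuous_on {a..b} (r x)"
          using cont'
        proof eventually_elim
          case (elim x)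
          show ?case
          proof
            assume "x \<in> {inverse (real (Suc m))..real (Suc m)}"
            then have "inverse (real (Suc m)) \<le> x" by simp
            with m have "0 < x" by (rule less_le_trans)
            then show "continuous_on {a..b} (r x)"
              using elim ab by (auto intro: continuous_on_subset)
          qed
        qed
      qed (use ab in auto)
    qed
  qed
  with cont' show ?thesis
  proof eventually_elim
    case (elim x)
    show ?case
    proof (intro impI ballI)
      fix y z assume x: "0 < x" and yz: "y \<in> {0..R}" "z \<in> {0..R}"
      have c: "continuous_on {0..R} (r x)" using elim x by blast
      obtain m1 :: nat where m1: "inverse (real (Suc m1)) < x" using reals_Archimedean[OF x] by blast
      obtain m2 :: nat where m2: "x \<le> m2" using real_arch_simple by blast
      define m where "m = max m1 m2"
      have "inverse (real (Suc m)) \<le> inverse (real (Suc m1))" by (intro le_imp_inverse_le) (auto simp: m_def)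
      then have "inverse (real (Suc m)) \<le> x" using m1 by linarith
      moreover have "x \<le> real (Suc m)" using m2 by (simp add: m_def)
      ultimately have xm: "x \<in> {inverse (real (Suc m))..real (Suc m)}" by simp
      show "\<bar>r x y - r x z\<bar> \<le> \<gamma> * \<bar>y - z\<bar>"
      proof (rule continuous_lipschitz_if_rational_lipschitz[OF c R \<gamma> _ yz])
        fix a b assume ab: "a \<in> \<rat>" "b \<in> \<rat>" "0 < a" "a < b" "b < R"
        show "\<bar>r x b - r x a\<bar> \<le> \<gamma> * (b - a)"
        proof (rule difference_le_if_plateau_integrals_le[OF ab(4)])
          show "continuous_on {a..b} (r x)" using c by (rule continuous_on_subset) (use ab in auto)
          show "\<bar>integral {a..b} (\<lambda>y. r x y * plateau' k a b y)\<bar> \<le> \<gamma> * (b - a)" for k :: nat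
            using elim(2)[rule_format, of "(a, b)" m k] ab xm by simp
        qed
      qed
    qed
  qed
qed

section \<open>Renewal inequality for the recently fired mass\<close>

lemma set_integral_reflect_Icc:
  fixes f :: "real \<Rightarrow> real"
  shows "(LBINT b:{0..s}. f (s - b)) = (LBINT x:{0..s}. f x)"
proof -
  have "(LBINT x:{0..s}. f x) = (LBINT b. indicator {0..s} (s + (- 1) * b) *\<^sub>R f (s + (- 1) * b))"
    unfolding set_lebesgue_integral_def by (subst lborel_integral_real_affine[where c="-1" and t=s]) auto
  also have "\<dots> = (LBINT b:{0..s}. f (s - b))"
    unfolding set_lebesgue_integral_def by (intro Bochner_Integration.integral_cong) (auto simp: indicator_def)
  finally show ?thesis by simp
qed

lemma set_integral_shift_Icc:
  fixes f :: "real \<Rightarrow> real"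
  shows "(LBINT s:{b..t}. f (s - b)) = (LBINT x:{0..t - b}. f x)"
proof -
  have "(LBINT s:{b..t}. f (s - b)) = (LBINT x. indicator {b..t} (b + 1 * x) *\<^sub>R f (b + 1 * x - b))"
    unfolding set_lebesgue_integral_def by (subst lborel_integral_real_affine[where c="1" and t=b]) auto
  also have "\<dots> = (LBINT x:{0..t - b}. f x)"
    unfolding set_lebesgue_integral_def by (intro Bochner_Integration.integral_cong) (auto simp: indicator_def)
  finally show ?thesis by simp
qed

lemma borel_measurable_indefinite_integral:
  fixes a :: "real \<Rightarrow> real"
  assumes "a \<in> borel_measurable borel" "\<And>x. \<bar>a x\<bar> \<le> K"
  shows "(\<lambda>t. LBINT s:{0..t}. a s) \<in> borel_measurable borel"
  using continuous_on_indefinite_integral[OF assms] by (rule borel_measurable_continuous_onI)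

lemma abs_indefinite_integral_le:
  fixes a :: "real \<Rightarrow> real"
  assumes "a \<in> borel_measurable borel" "\<And>x. \<bar>a x\<bar> \<le> K" "0 \<le> t"
  shows "\<bar>LBINT s:{0..t}. a s\<bar> \<le> K * t"
proof -
  have "(LBINT s:{0..t}. a s) = (LBINT s:{0<..t}. a s)"
    unfolding set_lebesgue_integral_def
    by (rule integral_cong_AE)
      (use assms(1) in \<open>auto simp: indicator_def intro!: eventually_mono[OF AE_lborel_singleton[of 0]]\<close>)
  then show ?thesis using abs_set_integral_Icc_le[OF assms(1,3), of K] assms(2) by simp
qed

text \<open>
\<open>G b\<close> is a rate of births and \<open>N\<close> the survival function with hazard rate \<open>c\<close>: what has been born
up to time \<open>t\<close> is either still alive or has died at some time \<open>s \<le> t\<close>. The proof is Fubini on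
the triangle \<open>0 \<le> b \<le> s \<le> t\<close>.
\<close>

lemma renewal_mass_balance:
  fixes c G :: "real \<Rightarrow> real"
  assumes c: "c \<in> borel_measurable borel" "\<And>x. \<bar>c x\<bar> \<le> K"
    and G: "G \<in> borel_measurable borel" "\<And>b. b \<in> {0..t} \<Longrightarrow> \<bar>G b\<bar> \<le> B" and t: "0 \<le> t"
  defines "N \<equiv> \<lambda>x. exp (- (LBINT y:{0..x}. c y))"
  shows "(LBINT b:{0..t}. N (t - b) * G b) +
      (LBINT s:{0..t}. (LBINT b:{0..s}. c (s - b) * N (s - b) * G b)) = (LBINT s:{0..t}. G s)"
    and "set_integrable lborel {0..t} (\<lambda>s. LBINT b:{0..s}. c (s - b) * N (s - b) * G b)"
proof -
  have K: "0 \<le> K" using c(2)[of 0] by linarith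
  have B: "0 \<le> B" using G(2)[of 0] t by force
  have [measurable]: "c \<in> borel_measurable borel" "G \<in> borel_measurable borel" by fact+
  have [measurable]: "N \<in> borel_measurable borel"
    unfolding N_def using borel_measurable_indefinite_integral[OF c] by measurable
  have N_bound: "\<bar>N x\<bar> \<le> exp (K * t)" if "0 \<le> x" "x \<le> t" for x
    using abs_indefinite_integral_le[OF c that(1)] mult_left_mono[OF that(2) K] by (simp add: N_def abs_le_iff)
  define f where "f = (\<lambda>s b. if 0 \<le> b \<and> b \<le> s \<and> s \<le> t then c (s - b) * N (s - b) * G b else 0)"
  have f_meas: "(\<lambda>(s, b). f s b) \<in> borel_measurable (lborel \<Otimes>\<^sub>M lborel)"
    unfolding f_def by measurable
  have f_bound: "\<bar>f s b\<bar> \<le> K * exp (K * t) * B * indicator ({0..t} \<times> {0..t}) (s, b)" for s b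
    using c(2)[of "s - b"] N_bound[of "s - b"] G(2)[of b] K B
    by (auto simp: f_def abs_mult intro!: mult_mono mult_nonneg_nonneg)
  have f_int: "integrable (lborel \<Otimes>\<^sub>M lborel) (\<lambda>(s, b). f s b)"
  proof (rule Bochner_Integration.integrable_bound)
    show "integrable (lborel \<Otimes>\<^sub>M lborel) (\<lambda>z. K * exp (K * t) * B * indicator ({0..t} \<times> {0..t}) z :: real)"
      unfolding lborel_prod
      by (intro integrable_mult_right integrable_real_indicator emeasure_compact_finite compact_Times)
        (auto intro!: borel_closed closed_Times)
    show "AE z in lborel \<Otimes>\<^sub>M lborel. norm (case z of (s, b) \<Rightarrow> f s b) \<le> norm (K * exp (K * t) * B * indicator ({0..t} \<times> {0..t}) z :: real)"
      using f_bound K B by (auto simp: abs_mult)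
  qed (rule f_meas)
  have inner: "(LBINT s. f s b) = indicator {0..t} b * ((1 - N (t - b)) * G b)" for b
  proof (cases "b \<in> {0..t}")
    case True
    have "(LBINT s. f s b) = (LBINT s:{b..t}. c (s - b) * N (s - b)) * G b"
      using True unfolding set_lebesgue_integral_def
      by (auto simp: f_def indicator_def intro!: Bochner_Integration.integral_cong simp flip: integral_mult_left_zero)
    also have "(LBINT s:{b..t}. c (s - b) * N (s - b)) = (LBINT x:{0..t - b}. c x * N x)"
      by (rule set_integral_shift_Icc)
    also have "\<dots> = 1 - N (t - b)"
    proof -
      have m: "(\<lambda>x. - c x) \<in> borel_measurable borel" by measurable
      have "(LBINT x:{0..t - b}. - c x * N x) = N (t - b) - 1"
        using integral_exp_indefinite_integral[OF m, of K "t - b"] c(2) True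
        by (simp add: N_def set_lebesgue_integral_def)
      then show ?thesis by (simp add: set_lebesgue_integral_def)
    qed
    finally show ?thesis using True by simp
  next
    case False
    then have "f s b = 0" for s by (auto simp: f_def)
    then show ?thesis using False by simp
  qed
  have eq: "indicator {0..t} s *\<^sub>R (LBINT b:{0..s}. c (s - b) * N (s - b) * G b) = (LBINT b. f s b)" for s
  proof (cases "s \<in> {0..t}")
    case True
    then show ?thesis
      unfolding set_lebesgue_integral_def
      by (auto simp: f_def indicator_def intro!: Bochner_Integration.integral_cong)
  next
    case False
    then have "f s b = 0" for b by (auto simp: f_def)
    then show ?thesis using False by simp
  qed
  show "set_integrable lborel {0..t} (\<lambda>s. LBINT b:{0..s}. c (s - b) * N (s - b) * G b)"
    unfolding set_integrable_def eq using lborel_pair.integrable_fst'[OF f_int] by simp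
  have "(LBINT s:{0..t}. (LBINT b:{0..s}. c (s - b) * N (s - b) * G b)) = (LBINT s. (LBINT b. f s b))"
    by (subst set_lebesgue_integral_def) (simp only: eq)
  also have "\<dots> = (LBINT b. (LBINT s. f s b))"
    using lborel_pair.Fubini_integral[OF f_int] by simp
  also have "\<dots> = (LBINT b:{0..t}. (1 - N (t - b)) * G b)"
    unfolding inner by (simp add: set_lebesgue_integral_def)
  also have "\<dots> = (LBINT b:{0..t}. G b - N (t - b) * G b)"
    by (simp add: algebra_simps)
  also have "\<dots> = (LBINT b:{0..t}. G b) - (LBINT b:{0..t}. N (t - b) * G b)"
  proof (rule set_integral_diff(2))
    show "set_integrable lborel {0..t} G"
      by (rule set_integrable_bounded_Icc[where a=0 and b=t and K=B]) (use G in auto)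
    show "set_integrable lborel {0..t} (\<lambda>b. N (t - b) * G b)"
    proof (rule set_integrable_bounded_Icc[where a=0 and b=t and K="exp (K * t) * B"])
      show "\<bar>N (t - b) * G b\<bar> \<le> exp (K * t) * B" if "b \<in> {0..t}" for b
        unfolding abs_mult using that N_bound[of "t - b"] G(2)[OF that] by (intro mult_mono) auto
    qed auto
  qed
  finally show "(LBINT b:{0..t}. N (t - b) * G b) +
      (LBINT s:{0..t}. (LBINT b:{0..s}. c (s - b) * N (s - b) * G b)) = (LBINT s:{0..t}. G s)" by simp
qed

text \<open>
\<open>exp (- D t) * Z t\<close> is the coupled mass. In the mass balance with weight \<open>exp (r0 * b)\<close> the
hazard is \<open>\<rho> - r0\<close>; the birth inequality cancels it and leaves the integral of \<open>(r0 - q s) * exp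
(r0 * s + D s)\<close> as a lower bound. With \<open>+ q\<close> in place of \<open>- q\<close> the integrand would be an exact
derivative, and the difference is the error term \<open>2 * q\<close>.
\<close>

lemma renewed_overlap_lower_bound:
  fixes \<rho> q \<kappa> :: "real \<Rightarrow> real"
  defines "D \<equiv> \<lambda>t. LBINT s:{0..t}. q s"
    and "E \<equiv> \<lambda>x. exp (- (LBINT y:{0..x}. \<rho> y))"
  defines "Z \<equiv> \<lambda>t. LBINT b:{0..t}. E (t - b) * (exp (D b) * \<kappa> b)"
  assumes \<rho>: "\<rho> \<in> borel_measurable borel" "\<And>x. \<bar>\<rho> x\<bar> \<le> K"
    and q: "q \<in> borel_measurable borel" "\<And>s. 0 \<le> q s" "\<And>s. q s \<le> Q"
    and \<kappa>: "\<kappa> \<in> borel_measurable borel" "\<And>b. 0 \<le> \<kappa> b" "\<And>b. \<kappa> b \<le> B"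
    and t: "0 \<le> t" and r0: "0 \<le> r0"
    and Z_le: "\<And>s. s \<in> {0..t} \<Longrightarrow> Z s \<le> exp (D s)"
    and birth: "AE s in lborel. s \<in> {0..t} \<longrightarrow>
      r0 * exp (D s) + (LBINT b:{0..s}. (\<rho> (s - b) - q s - r0) * (E (s - b) * (exp (D b) * \<kappa> b)))
        \<le> exp (D s) * \<kappa> s"
  shows "1 - exp (- D t) * Z t \<le> exp (- r0 * t) + 2 * (LBINT s:{0..t}. q s * exp (- r0 * (t - s)))"
proof -
  have K: "0 \<le> K" using \<rho>(2)[of 0] by linarith
  have Q: "0 \<le> Q" using q(2,3)[of 0] by linarith
  have B: "0 \<le> B" using \<kappa>(2,3)[of 0] by linarith
  have [measurable]: "\<rho> \<in> borel_measurable borel" "q \<in> borel_measurable borel" "\<kappa> \<in> borel_measurable borel" by fact+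
  have q': "\<bar>q s\<bar> \<le> Q" for s using q by simp
  have D_meas [measurable]: "D \<in> borel_measurable borel"
    unfolding D_def by (rule borel_measurable_indefinite_integral[OF q(1) q'])
  have E_meas [measurable]: "E \<in> borel_measurable borel"
    unfolding E_def using borel_measurable_indefinite_integral[OF \<rho>] by measurable
  have D_nonneg: "0 \<le> D s" for s
    unfolding D_def set_lebesgue_integral_def using q(2) by (intro Bochner_Integration.integral_nonneg) auto
  have D_mono: "D s \<le> D u" if "0 \<le> s" "s \<le> u" for s u
  proof -
    have "0 \<le> (LBINT x:{s<..u}. q x)"
      unfolding set_lebesgue_integral_def using q(2) by (intro Bochner_Integration.integral_nonneg) auto
    then show ?thesis
      using set_integral_Icc_split[OF q(1), of 0 s u Q] q' that unfolding D_def by simp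
  qed
  have D_le: "D s \<le> Q * t" if "s \<in> {0..t}" for s
    using D_mono[of s t] abs_indefinite_integral_le[OF q(1) q' t] that by (simp add: D_def)
  \<comment> \<open>the factor \<open>exp (r0 * x)\<close> lowers the hazard from \<open>\<rho>\<close> to \<open>\<rho> - r0\<close>\<close>
  define c where "c = (\<lambda>x. \<rho> x - r0)"
  have c: "c \<in> borel_measurable borel" "\<bar>c x\<bar> \<le> K + r0" for x
    using \<rho>(2)[of x] r0 by (auto simp: c_def abs_le_iff)
  define N where "N = (\<lambda>x. exp (- (LBINT y:{0..x}. c y)))"
  have N_eq: "N x = exp (r0 * x) * E x" if "0 \<le> x" for x
  proof -
    have "set_integrable lborel {0..x} \<rho>" "set_integrable lborel {0..x} (\<lambda>_. r0)"
      by (rule set_integrable_bounded_Icc[where a=0 and b=x and K=K], use \<rho>(2) in auto)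
        (rule set_integrable_bounded_Icc[where a=0 and b=x and K=r0], use r0 in auto)
    then have "(LBINT y:{0..x}. c y) = (LBINT y:{0..x}. \<rho> y) - (LBINT y:{0..x}. r0)"
      unfolding c_def by (rule set_integral_diff(2))
    also have "(LBINT y:{0..x}. r0) = r0 * x" using that by (subst set_integral_const) auto
    finally show ?thesis by (simp add: N_def E_def exp_diff exp_minus divide_inverse)
  qed
  have E_bound: "\<bar>E x\<bar> \<le> exp (K * t)" if "0 \<le> x" "x \<le> t" for x
    using abs_indefinite_integral_le[OF \<rho> that(1)] mult_left_mono[OF that(2) K] by (simp add: E_def abs_le_iff)
  define X where "X = (\<lambda>b. exp (D b) * \<kappa> b)"
  have X_meas [measurable]: "X \<in> borel_measurable borel" unfolding X_def by measurable
  have X_bound: "\<bar>X b\<bar> \<le> exp (Q * t) * B" if "b \<in> {0..t}" for b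
    unfolding X_def abs_mult using D_le[OF that] \<kappa>(2,3)[of b] by (intro mult_mono) auto
  define G where "G = (\<lambda>b. exp (r0 * b) * X b)"
  have G_meas [measurable]: "G \<in> borel_measurable borel" unfolding G_def by measurable
  have G_bound: "\<bar>G b\<bar> \<le> exp (r0 * t) * (exp (Q * t) * B)" if "b \<in> {0..t}" for b
    unfolding G_def abs_mult using X_bound[OF that] that r0 by (intro mult_mono) (auto intro: mult_left_mono)
  define inner where "inner = (\<lambda>s. LBINT b:{0..s}. c (s - b) * N (s - b) * G b)"
  have bal: "(LBINT b:{0..t}. N (t - b) * G b) + (LBINT s:{0..t}. inner s) = (LBINT s:{0..t}. G s)"
    "set_integrable lborel {0..t} inner"
    using renewal_mass_balance[OF c G_meas G_bound t] unfolding N_def inner_def by blast+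
  have "(LBINT b:{0..t}. N (t - b) * G b) = (LBINT b:{0..t}. exp (r0 * t) * (E (t - b) * X b))"
    by (rule set_lebesgue_integral_cong)
      (auto simp: N_eq G_def algebra_simps simp flip: exp_add)
  then have bal': "exp (r0 * t) * Z t = (LBINT s:{0..t}. G s) - (LBINT s:{0..t}. inner s)"
    using bal(1) by (simp add: Z_def X_def)
  have inner_eq: "inner s = exp (r0 * s) * (LBINT b:{0..s}. c (s - b) * (E (s - b) * X b))" for s
  proof -
    have "inner s = (LBINT b:{0..s}. exp (r0 * s) * (c (s - b) * (E (s - b) * X b)))"
      unfolding inner_def
      by (rule set_lebesgue_integral_cong)
        (auto simp: N_eq G_def algebra_simps simp flip: exp_add)
    then show ?thesis by simp
  qed
  define e where "e = (\<lambda>s. exp (r0 * s + D s))"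
  have e_meas [measurable]: "e \<in> borel_measurable borel" unfolding e_def by measurable
  have e_bound: "\<bar>e s\<bar> \<le> exp (r0 * t + Q * t)" if "s \<in> {0..t}" for s
    unfolding e_def using D_le[OF that] that r0 by (auto intro!: add_mono mult_left_mono)
  have si: "set_integrable lborel {0..t} (\<lambda>s. h s * e s)"
    if "h \<in> borel_measurable borel" "\<And>s. \<bar>h s\<bar> \<le> H" for h H
  proof (rule set_integrable_bounded_Icc[where a=0 and b=t and K="H * exp (r0 * t + Q * t)"])
    show "\<bar>h s * e s\<bar> \<le> H * exp (r0 * t + Q * t)" if "s \<in> {0..t}" for s
      unfolding abs_mult using e_bound[OF that] \<open>\<And>s. \<bar>h s\<bar> \<le> H\<close>[of s] \<open>\<And>s. \<bar>h s\<bar> \<le> H\<close>[of s] by (intro mult_mono) auto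
  qed (use that in measurable)
  have G_int: "set_integrable lborel {0..t} G"
    by (rule set_integrable_bounded_Icc[where a=0 and b=t and K="exp (r0 * t) * (exp (Q * t) * B)"]) (use G_bound in auto)
  have "(LBINT s:{0..t}. (r0 - q s) * e s) \<le> (LBINT s:{0..t}. G s - inner s)"
  proof (rule set_integral_mono_AE)
    show "set_integrable lborel {0..t} (\<lambda>s. (r0 - q s) * e s)"
    proof (rule si[of _ "r0 + Q"])
      show "\<bar>r0 - q s\<bar> \<le> r0 + Q" for s using q(2,3)[of s] r0 by (auto simp: abs_le_iff)
    qed measurable
    show "set_integrable lborel {0..t} (\<lambda>s. G s - inner s)"
      by (rule set_integral_diff(1)[OF G_int bal(2)])
    show "AE s\<in>{0..t} in lborel. (r0 - q s) * e s \<le> G s - inner s"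
      using birth
    proof eventually_elim
      case (elim s)
      show ?case
      proof
        assume s: "s \<in> {0..t}"
        have 1: "set_integrable lborel {0..s} (\<lambda>b. h (s - b) * (E (s - b) * X b))"
          if "h \<in> borel_measurable borel" "\<And>s. \<bar>h s\<bar> \<le> H" for h H
        proof (rule set_integrable_bounded_Icc[where a=0 and b=s and K="H * (exp (K * t) * (exp (Q * t) * B))"])
          have H: "0 \<le> H" using that(2)[of 0] by linarith
          show "\<bar>h (s - b) * (E (s - b) * X b)\<bar> \<le> H * (exp (K * t) * (exp (Q * t) * B))" if "b \<in> {0..s}" for b
            unfolding abs_mult using E_bound[of "s - b"] X_bound[of b] s that H \<open>\<And>s. \<bar>h s\<bar> \<le> H\<close>[of "s - b"]
            by (intro mult_mono) auto
        qed (use that in measurable)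
        have "(LBINT b:{0..s}. (\<rho> (s - b) - q s - r0) * (E (s - b) * X b))
            = (LBINT b:{0..s}. c (s - b) * (E (s - b) * X b) - q s * (E (s - b) * X b))"
          by (simp add: c_def algebra_simps)
        also have "\<dots> = (LBINT b:{0..s}. c (s - b) * (E (s - b) * X b)) - (LBINT b:{0..s}. q s * (E (s - b) * X b))"
          by (rule set_integral_diff(2)) (use 1[OF c] 1[of "\<lambda>_. q s", OF _ q'] in auto)
        also have "\<dots> = (LBINT b:{0..s}. c (s - b) * (E (s - b) * X b)) - q s * Z s"
          by (simp add: Z_def X_def)
        finally have "r0 * exp (D s) + ((LBINT b:{0..s}. c (s - b) * (E (s - b) * X b)) - q s * Z s) \<le> X s"
          using elim s by (simp add: X_def)
        moreover have "q s * Z s \<le> q s * exp (D s)" using Z_le[OF s] q(2) by (rule mult_left_mono)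
        ultimately have "(r0 - q s) * exp (D s) \<le> X s - (LBINT b:{0..s}. c (s - b) * (E (s - b) * X b))"
          by (simp add: algebra_simps)
        then have "exp (r0 * s) * ((r0 - q s) * exp (D s)) \<le> exp (r0 * s) * (X s - (LBINT b:{0..s}. c (s - b) * (E (s - b) * X b)))"
          by (rule mult_left_mono) simp
        then show "(r0 - q s) * e s \<le> G s - inner s"
          unfolding inner_eq G_def e_def exp_add by (simp add: algebra_simps)
      qed
    qed
  qed
  also have "\<dots> = exp (r0 * t) * Z t"
    unfolding bal' by (rule set_integral_diff(2)[OF G_int bal(2)])
  finally have 1: "(LBINT s:{0..t}. (r0 - q s) * e s) \<le> exp (r0 * t) * Z t" .
  define J where "J = (LBINT s:{0..t}. q s * e s)"
  have q_int: "set_integrable lborel {0..t} (\<lambda>s. q s * e s)" by (rule si[OF q(1) q'])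
  have 2: "(LBINT s:{0..t}. (r0 + q s) * e s) = exp (r0 * t + D t) - 1"
  proof -
    have A: "(LBINT y:{0..s}. r0 + q y) = r0 * s + D s" if "0 \<le> s" for s
    proof -
      have "set_integrable lborel {0..s} q" "set_integrable lborel {0..s} (\<lambda>_. r0)"
        by (rule set_integrable_bounded_Icc[where a=0 and b=s and K=Q], use q' in auto)
          (rule set_integrable_bounded_Icc[where a=0 and b=s and K=r0], use r0 in auto)
      then have "(LBINT y:{0..s}. r0 + q y) = (LBINT y:{0..s}. r0) + D s"
        unfolding D_def by (intro set_integral_add(2))
      also have "(LBINT y:{0..s}. r0) = r0 * s" using that by (subst set_integral_const) auto
      finally show ?thesis .
    qed
    have "(LBINT s:{0..t}. (r0 + q s) * e s) = (LBINT s:{0..t}. (r0 + q s) * exp (LBINT y:{0..s}. r0 + q y))"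
      by (rule set_lebesgue_integral_cong) (auto simp: A e_def)
    also have "\<dots> = exp (LBINT y:{0..t}. r0 + q y) - 1"
    proof (rule integral_exp_indefinite_integral[of _ "r0 + Q"])
      show "\<bar>r0 + q s\<bar> \<le> r0 + Q" for s using q(2,3)[of s] r0 by (auto simp: abs_le_iff)
    qed (use t in auto)
    finally show ?thesis using A[OF t] by simp
  qed
  have r0_int: "set_integrable lborel {0..t} (\<lambda>s. r0 * e s)" by (rule si[of _ r0]) (use r0 in auto)
  have "(LBINT s:{0..t}. (r0 + q s) * e s) = (LBINT s:{0..t}. r0 * e s) + J"
    unfolding J_def distrib_right by (rule set_integral_add(2)[OF r0_int q_int])
  moreover have "(LBINT s:{0..t}. (r0 - q s) * e s) = (LBINT s:{0..t}. r0 * e s) - J"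
    unfolding J_def left_diff_distrib by (rule set_integral_diff(2)[OF r0_int q_int])
  ultimately have 3: "exp (r0 * t + D t) - 1 - 2 * J \<le> exp (r0 * t) * Z t" using 1 2 by linarith
  have J_le: "J \<le> exp (r0 * t + D t) * (LBINT s:{0..t}. q s * exp (- r0 * (t - s)))"
  proof -
    have "J \<le> (LBINT s:{0..t}. exp (r0 * t + D t) * (q s * exp (- r0 * (t - s))))"
      unfolding J_def
    proof (rule set_integral_mono[OF q_int])
      show "set_integrable lborel {0..t} (\<lambda>s. exp (r0 * t + D t) * (q s * exp (- r0 * (t - s))))"
      proof (intro set_integrable_mult_right set_integrable_bounded_Icc[where a=0 and b=t and K="Q"])
        show "\<bar>q s * exp (- r0 * (t - s))\<bar> \<le> Q" if "s \<in> {0..t}" for s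
        proof -
          have "q s * exp (- r0 * (t - s)) \<le> Q * 1" using that q r0 Q by (intro mult_mono) auto
          then show ?thesis using q(2) by simp
        qed
      qed auto
      fix s assume s: "s \<in> {0..t}"
      have "e s \<le> exp (r0 * t + D t) * exp (- r0 * (t - s))"
        using D_mono[of s t] s by (simp add: e_def algebra_simps flip: exp_add)
      from mult_left_mono[OF this q(2)[of s]]
      show "q s * e s \<le> exp (r0 * t + D t) * (q s * exp (- r0 * (t - s)))" by (simp add: mult_ac)
    qed
    then show ?thesis by simp
  qed
  define L where "L = exp (r0 * t + D t)"
  have L: "0 < L" by (simp add: L_def)
  have "L - 1 - 2 * (L * (LBINT s:{0..t}. q s * exp (- r0 * (t - s)))) \<le> exp (r0 * t) * Z t"
    using 3 J_le unfolding L_def by linarith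
  then have "inverse L * (L - 1 - 2 * (L * (LBINT s:{0..t}. q s * exp (- r0 * (t - s))))) \<le> inverse L * (exp (r0 * t) * Z t)"
    using L by (intro mult_left_mono) auto
  moreover have "inverse L * (exp (r0 * t) * Z t) = exp (- D t) * Z t"
    by (simp add: L_def exp_add exp_minus)
  moreover have "inverse L * (L - 1 - 2 * (L * (LBINT s:{0..t}. q s * exp (- r0 * (t - s)))))
      = 1 - inverse L - 2 * (LBINT s:{0..t}. q s * exp (- r0 * (t - s)))"
    using L by (simp add: field_simps)
  moreover have "inverse L \<le> exp (- r0 * t)"
    using D_nonneg[of t] by (simp add: L_def flip: exp_minus)
  ultimately show ?thesis by linarith
qed

section \<open>Comparing two densities through a common part\<close>

text \<open>
Two probability densities \<open>n\<close> and \<open>m\<close> share the part \<open>W\<close>, and two rates \<open>a\<close> and \<open>\<rho>\<close> differ by at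
most \<open>\<eta>\<close>. The lower bounds use the rate \<open>r0\<close> outside \<open>W\<close> and \<open>\<rho> - \<eta>\<close> on \<open>W\<close>. In the last
estimate, replacing \<open>a\<close> by \<open>\<rho>\<close> costs \<open>\<eta>\<close> on the whole mass of \<open>n\<close>, and the integral of \<open>\<rho> * (n -
m)\<close> is bounded on either side by what lies outside \<open>W\<close>.
\<close>

lemma common_part_estimates:
  fixes n m W a \<rho> :: "'a \<Rightarrow> real"
  assumes int: "integrable M n" "integrable M m" "W \<in> borel_measurable M"
    and mass: "integral\<^sup>L M n = 1" "integral\<^sup>L M m = 1"
    and meas: "a \<in> borel_measurable M" "\<rho> \<in> borel_measurable M"
    and W: "AE x in M. 0 \<le> W x \<and> W x \<le> n x \<and> W x \<le> m x"
    and rates: "AE x in M. r0 \<le> a x \<and> a x \<le> R \<and> r0 \<le> \<rho> x \<and> \<rho> x \<le> R \<and> \<bar>a x - \<rho> x\<bar> \<le> \<eta>"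
    and nonneg: "0 \<le> r0" "r0 \<le> R" "0 \<le> \<eta>"
  shows "integrable M W" "integrable M (\<lambda>x. (\<rho> x - \<eta> - r0) * W x)"
    and "integral\<^sup>L M W \<le> 1"
    and "(LINT x|M. \<bar>n x - m x\<bar>) \<le> 2 * (1 - integral\<^sup>L M W)"
    and "r0 + (LINT x|M. (\<rho> x - \<eta> - r0) * W x) \<le> (LINT x|M. a x * n x)"
    and "r0 + (LINT x|M. (\<rho> x - \<eta> - r0) * W x) \<le> (LINT x|M. \<rho> x * m x)"
    and "\<bar>(LINT x|M. a x * n x) - (LINT x|M. \<rho> x * m x)\<bar> \<le> \<eta> + R * (1 - integral\<^sup>L M W)"
proof -
  have R: "0 \<le> R" using nonneg by linarith
  show W_int: "integrable M W"
    by (rule Bochner_Integration.integrable_bound[OF int(1,3)]) (rule eventually_mono[OF W], auto)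
  have mult_int: "integrable M (\<lambda>x. h x * f x)"
    if "integrable M f" "h \<in> borel_measurable M" "AE x in M. \<bar>h x\<bar> \<le> H" for h f :: "'a \<Rightarrow> real" and H
  proof (rule Bochner_Integration.integrable_bound)
    show "integrable M (\<lambda>x. \<bar>H\<bar> * f x)" using that(1) by simp
    show "(\<lambda>x. h x * f x) \<in> borel_measurable M" using that by measurable
    show "AE x in M. norm (h x * f x) \<le> norm (\<bar>H\<bar> * f x)"
      using that(3) by eventually_elim (auto simp: abs_mult intro!: mult_right_mono)
  qed
  have an: "integrable M (\<lambda>x. a x * n x)"
    by (rule mult_int[OF int(1) meas(1), of R]) (rule eventually_mono[OF rates], use nonneg in auto)
  have \<rho>m: "integrable M (\<lambda>x. \<rho> x * m x)"
    by (rule mult_int[OF int(2) meas(2), of R]) (rule eventually_mono[OF rates], use nonneg in auto)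
  show W'_int: "integrable M (\<lambda>x. (\<rho> x - \<eta> - r0) * W x)"
  proof (rule mult_int[OF W_int])
    show "AE x in M. \<bar>\<rho> x - \<eta> - r0\<bar> \<le> R + \<eta> + r0"
      by (rule eventually_mono[OF rates]) (use nonneg in \<open>auto simp: abs_le_iff\<close>)
  qed (use meas in measurable)
  show "integral\<^sup>L M W \<le> 1"
    unfolding mass(1)[symmetric] by (rule integral_mono_AE[OF W_int int(1)]) (rule eventually_mono[OF W], auto)
  have "(LINT x|M. \<bar>n x - m x\<bar>) \<le> (LINT x|M. n x + m x - 2 * W x)"
  proof (rule integral_mono_AE)
    show "AE x in M. \<bar>n x - m x\<bar> \<le> n x + m x - 2 * W x"
      by (rule eventually_mono[OF W]) (auto simp: abs_le_iff)
  qed (use int W_int in auto)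
  also have "\<dots> = 2 * (1 - integral\<^sup>L M W)"
    using int W_int mass by simp
  finally show "(LINT x|M. \<bar>n x - m x\<bar>) \<le> 2 * (1 - integral\<^sup>L M W)" .
  have lower: "r0 + (LINT x|M. (\<rho> x - \<eta> - r0) * W x) \<le> (LINT x|M. h x * f x)"
    if "integrable M f" "integral\<^sup>L M f = 1" "AE x in M. W x \<le> f x" "integrable M (\<lambda>x. h x * f x)"
      "AE x in M. r0 \<le> h x \<and> \<rho> x - \<eta> \<le> h x" for h f :: "'a \<Rightarrow> real"
  proof -
    have "r0 + (LINT x|M. (\<rho> x - \<eta> - r0) * W x) = (LINT x|M. r0 * f x + (\<rho> x - \<eta> - r0) * W x)"
      using that W'_int by simp
    also have "\<dots> \<le> (LINT x|M. h x * f x)"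
    proof (rule integral_mono_AE)
      show "AE x in M. r0 * f x + (\<rho> x - \<eta> - r0) * W x \<le> h x * f x"
        using that(3,5) W
      proof eventually_elim
        case (elim x)
        have "(\<rho> x - \<eta> - r0) * W x \<le> (h x - r0) * W x" using elim by (intro mult_right_mono) auto
        also have "\<dots> \<le> (h x - r0) * f x" using elim by (intro mult_left_mono) auto
        finally show ?case by (simp add: algebra_simps)
      qed
    qed (use that W'_int in auto)
    finally show ?thesis .
  qed
  show "r0 + (LINT x|M. (\<rho> x - \<eta> - r0) * W x) \<le> (LINT x|M. a x * n x)"
    by (rule lower[OF int(1) mass(1) _ an]) (rule eventually_mono[OF W], simp, rule eventually_mono[OF rates], auto)
  show "r0 + (LINT x|M. (\<rho> x - \<eta> - r0) * W x) \<le> (LINT x|M. \<rho> x * m x)"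
    by (rule lower[OF int(2) mass(2) _ \<rho>m]) (rule eventually_mono[OF W], simp, rule eventually_mono[OF rates], use nonneg in auto)
  have "(LINT x|M. a x * n x) - (LINT x|M. \<rho> x * m x) = (LINT x|M. a x * n x - \<rho> x * m x)"
    using an \<rho>m by simp
  also have "\<dots> \<le> (LINT x|M. \<eta> * n x + R * (n x - W x))"
  proof (rule integral_mono_AE)
    show "AE x in M. a x * n x - \<rho> x * m x \<le> \<eta> * n x + R * (n x - W x)"
      using W rates
    proof eventually_elim
      case (elim x)
      have "a x * n x \<le> (\<rho> x + \<eta>) * n x" using elim by (intro mult_right_mono) auto
      moreover have "\<rho> x * W x \<le> \<rho> x * m x" using elim nonneg by (intro mult_left_mono) auto
      moreover have "\<rho> x * (n x - W x) \<le> R * (n x - W x)" using elim by (intro mult_right_mono) auto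
      ultimately show ?case by (simp add: algebra_simps)
    qed
  qed (use int W_int an \<rho>m in auto)
  also have "\<dots> = \<eta> + R * (1 - integral\<^sup>L M W)" using int W_int mass by simp
  finally have 1: "(LINT x|M. a x * n x) - (LINT x|M. \<rho> x * m x) \<le> \<eta> + R * (1 - integral\<^sup>L M W)" .
  have "(LINT x|M. \<rho> x * m x) - (LINT x|M. a x * n x) = (LINT x|M. \<rho> x * m x - a x * n x)"
    using an \<rho>m by simp
  also have "\<dots> \<le> (LINT x|M. \<eta> * n x + R * (m x - W x))"
  proof (rule integral_mono_AE)
    show "AE x in M. \<rho> x * m x - a x * n x \<le> \<eta> * n x + R * (m x - W x)"
      using W rates
    proof eventually_elim
      case (elim x)
      have "(\<rho> x - \<eta>) * n x \<le> a x * n x" using elim by (intro mult_right_mono) auto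
      moreover have "\<rho> x * W x \<le> \<rho> x * n x" using elim nonneg by (intro mult_left_mono) auto
      moreover have "\<rho> x * (m x - W x) \<le> R * (m x - W x)" using elim by (intro mult_right_mono) auto
      ultimately show ?case by (simp add: algebra_simps)
    qed
  qed (use int W_int an \<rho>m in auto)
  also have "\<dots> = \<eta> + R * (1 - integral\<^sup>L M W)" using int W_int mass by simp
  finally show "\<bar>(LINT x|M. a x * n x) - (LINT x|M. \<rho> x * m x)\<bar> \<le> \<eta> + R * (1 - integral\<^sup>L M W)"
    using 1 by linarith
qed

lemma AE_lborel_affine:
  fixes P :: "real \<Rightarrow> bool"
  assumes "AE x in lborel. P x" "c \<noteq> 0"
  shows "AE x in lborel. P (t + c * x)"
proof -
  obtain N where N: "N \<in> null_sets lborel" "{x. \<not> P x} \<subseteq> N"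
    using assms(1) by (auto elim: AE_E simp: null_sets_def)
  have "Measurable.pred borel (\<lambda>x. x \<notin> N)" using N(1) by auto
  then have "AE x in lborel. t + c * x \<notin> N"
    using AE_borel_affine[OF assms(2) _ AE_not_in[OF N(1)]] by blast
  then show ?thesis by eventually_elim (use N(2) in auto)
qed

text \<open>
The product of two Lebesgue measures is not complete, so Fubini's theorem is applied to Borel
functions, while rates and activities are merely Lebesgue measurable. Truncation keeps the
bounds valid at every point.
\<close>

lemma bounded_borel_representative:
  fixes f :: "real \<Rightarrow> real"
  assumes f: "f \<in> borel_measurable (lebesgue_on S)" and S: "S \<in> sets borel"
    and b: "\<And>x. x \<in> S \<Longrightarrow> l \<le> f x \<and> f x \<le> u" and lu: "l \<le> u"
  shows "\<exists>g\<in>borel_measurable borel. (\<forall>x. l \<le> g x \<and> g x \<le> u) \<and> (AE x in lborel. x \<in> S \<longrightarrow> f x = g x)"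
proof -
  have "(\<lambda>x. if x \<in> S then f x else 0) \<in> borel_measurable lebesgue"
    using S by (intro borel_measurable_if_I[OF f]) simp
  then obtain g where g: "g \<in> borel_measurable lborel" "AE x in lborel. (if x \<in> S then f x else 0) = g x"
    using completion_ex_borel_measurable_real by blast
  show ?thesis
  proof (intro bexI[of _ "\<lambda>x. max l (min u (g x))"] conjI allI)
    show "(\<lambda>x. max l (min u (g x))) \<in> borel_measurable borel" using g(1) by simp
    show "AE x in lborel. x \<in> S \<longrightarrow> f x = max l (min u (g x))"
      using g(2)
    proof eventually_elim
      case (elim x)
      then show ?case using b[of x] by auto
    qed
  qed (use lu in auto)
qed

lemma borel_measurable_lebesgue_if_AE_eq_borel:
  fixes f g :: "real \<Rightarrow> real"
  assumes "g \<in> borel_measurable borel" "AE x in lborel. f x = g x"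
  shows "f \<in> borel_measurable lebesgue"
proof (rule borel_measurable_AE)
  show "g \<in> borel_measurable lebesgue" using assms(1) by (intro measurable_completion) simp
  show "AE x in lebesgue. g x = f x"
    using AE_completion[OF assms(2)] by eventually_elim simp
qed

lemma set_integral_lebesgue_eq_lborel:
  fixes f g :: "real \<Rightarrow> real"
  assumes g: "g \<in> borel_measurable borel" and S: "S \<in> sets borel"
    and eq: "AE x in lborel. x \<in> S \<longrightarrow> f x = g x"
  shows "(LINT x:S|lebesgue. f x) = (LBINT x:S. g x)"
proof -
  have m: "(\<lambda>x. indicator S x *\<^sub>R g x) \<in> borel_measurable borel" using g S by measurable
  have eq': "AE x in lborel. indicator S x *\<^sub>R f x = indicator S x *\<^sub>R g x"
    using eq by eventually_elim (auto simp: indicator_def)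
  have "(LINT x:S|lebesgue. f x) = (LINT x:S|lebesgue. g x)"
    unfolding set_lebesgue_integral_def
  proof (rule integral_cong_AE)
    show "(\<lambda>x. indicator S x *\<^sub>R f x) \<in> borel_measurable lebesgue"
      by (rule borel_measurable_lebesgue_if_AE_eq_borel[OF m eq'])
    show "(\<lambda>x. indicator S x *\<^sub>R g x) \<in> borel_measurable lebesgue"
      using m by (intro measurable_completion) simp
  qed (rule AE_completion[OF eq'])
  also have "\<dots> = (LBINT x:S. g x)"
    unfolding set_lebesgue_integral_def using m by (intro integral_completion) simp
  finally show ?thesis .
qed

section \<open>The steady state as a renewal density\<close>

text \<open>
The death density \<open>\<rho> * E\<close> is the negative derivative of the survival function \<open>E\<close>, which decays
like \<open>exp (- r0 * x)\<close>, so it has mass \<open>1\<close>; since \<open>\<rho>\<close> lies between \<open>r0\<close> and \<open>R\<close>, this also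
controls the integral of \<open>E\<close>.
\<close>

lemma survival_integrals:
  fixes \<rho> :: "real \<Rightarrow> real"
  assumes \<rho>: "\<rho> \<in> borel_measurable borel" and r0: "0 < r0" and b: "\<And>x. r0 \<le> \<rho> x" "\<And>x. \<rho> x \<le> R"
  defines "E \<equiv> \<lambda>x. exp (- (LBINT y:{0..x}. \<rho> y))"
  shows "E \<in> borel_measurable borel"
    and "set_integrable lborel {0<..} E" and "0 < (LBINT x:{0<..}. E x)"
    and "(LBINT x:{0<..}. \<rho> x * E x) = 1"
proof -
  have abs_\<rho>: "\<bar>\<rho> x\<bar> \<le> R" for x using b[of x] r0 by auto
  have R: "0 < R" using b[of 0] r0 by linarith
  have [measurable]: "\<rho> \<in> borel_measurable borel" by fact
  show E_meas [measurable]: "E \<in> borel_measurable borel"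
    unfolding E_def using borel_measurable_indefinite_integral[OF \<rho> abs_\<rho>] by measurable
  have E_pos: "0 < E x" for x by (simp add: E_def)
  have E_le: "E x \<le> exp (- (r0 * x))" if "0 \<le> x" for x
  proof -
    have "set_integrable lborel {0..x} (\<lambda>_. r0)" "set_integrable lborel {0..x} \<rho>"
      by (rule set_integrable_bounded_Icc[where a=0 and b=x and K=r0], use r0 in auto)
        (rule set_integrable_bounded_Icc[where a=0 and b=x and K=R], use abs_\<rho> in auto)
    then have "(LBINT y:{0..x}. r0) \<le> (LBINT y:{0..x}. \<rho> y)"
      using b(1) by (intro set_integral_mono) auto
    moreover have "(LBINT y:{0..x}. r0) = r0 * x" using that by (subst set_integral_const) auto
    ultimately show ?thesis by (simp add: E_def)
  qed
  have E_le1: "E x \<le> 1" if "0 \<le> x" for x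
    using E_le[OF that] mult_nonneg_nonneg[of r0 x] r0 that by (auto intro: order_trans)
  have FTC: "(LBINT x:{0..T}. \<rho> x * E x) = 1 - E T" if "0 \<le> T" for T
  proof -
    have m: "(\<lambda>x. - \<rho> x) \<in> borel_measurable borel" by measurable
    have "(LBINT x:{0..T}. - \<rho> x * E x) = E T - 1"
      using integral_exp_indefinite_integral[OF m, of R T] abs_\<rho> that
      by (simp add: E_def set_lebesgue_integral_def)
    then show ?thesis by (simp add: set_lebesgue_integral_def)
  qed
  have "has_bochner_integral lborel (\<lambda>x. indicator {0<..} x * (\<rho> x * E x)) 1"
  proof (rule has_bochner_integral_monotone_convergence_at_top)
    show "AE x in lborel. 0 \<le> indicator {0<..} x * (\<rho> x * E x)"
      using b(1) r0 E_pos by (intro AE_I2 mult_nonneg_nonneg) (auto intro: order_trans less_imp_le)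
    fix T :: real
    have eq: "indicator {0<..} x * (\<rho> x * E x) * indicator {..T} x = indicator {0<..T} x *\<^sub>R (\<rho> x * E x)" for x
      by (auto simp: indicator_def)
    have "set_integrable lborel {0<..T} (\<lambda>x. \<rho> x * E x)"
    proof (rule set_integrable_bounded_Icc[where a=0 and b=T and K="R * 1"])
      show "\<bar>\<rho> x * E x\<bar> \<le> R * 1" if "x \<in> {0<..T}" for x
        unfolding abs_mult using abs_\<rho>[of x] E_le1[of x] E_pos[of x] that by (intro mult_mono) auto
    qed auto
    then show "integrable lborel (\<lambda>x. indicator {0<..} x * (\<rho> x * E x) * indicator {..T} x)"
      unfolding eq by (simp add: set_integrable_def)
  next
    have "((\<lambda>T. 1 - E T) \<longlongrightarrow> 1 - 0) at_top"
    proof (intro tendsto_diff tendsto_const)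
      show "(E \<longlongrightarrow> 0) at_top"
      proof (rule tendsto_sandwich)
        show "\<forall>\<^sub>F x in at_top. 0 \<le> E x" using E_pos by (intro always_eventually allI less_imp_le)
        show "\<forall>\<^sub>F x in at_top. E x \<le> exp (- (r0 * x))"
          using eventually_ge_at_top[of 0] by eventually_elim (rule E_le)
        show "((\<lambda>x. exp (- (r0 * x))) \<longlongrightarrow> 0) at_top"
          using r0 by real_asymp
      qed auto
    qed
    moreover have "\<forall>\<^sub>F T in at_top. 1 - E T = (LBINT x. indicator {0<..} x * (\<rho> x * E x) * indicator {..T} x)"
      using eventually_ge_at_top[of 0]
    proof eventually_elim
      case (elim T)
      have "(LBINT x. indicator {0<..} x * (\<rho> x * E x) * indicator {..T} x) = (LBINT x:{0..T}. \<rho> x * E x)"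
        unfolding set_lebesgue_integral_def
        by (rule integral_cong_AE) (auto simp: indicator_def intro!: eventually_mono[OF AE_lborel_singleton[of 0]])
      then show ?case using FTC[OF elim] by simp
    qed
    ultimately show "((\<lambda>T. LBINT x. indicator {0<..} x * (\<rho> x * E x) * indicator {..T} x) \<longlongrightarrow> 1) at_top"
      by (simp add: filterlim_cong)
  qed auto
  then have \<rho>E: "set_integrable lborel {0<..} (\<lambda>x. \<rho> x * E x)" "(LBINT x:{0<..}. \<rho> x * E x) = 1"
    by (auto simp: set_integrable_def set_lebesgue_integral_def has_bochner_integral_iff)
  then show "(LBINT x:{0<..}. \<rho> x * E x) = 1" by simp
  have "set_integrable lborel {0<..} (\<lambda>x. inverse r0 * (\<rho> x * E x))" using \<rho>E(1) by simp
  then show E_int: "set_integrable lborel {0<..} E"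
  proof (rule set_integrable_bound)
    show "set_borel_measurable lborel {0<..} E" by (simp add: set_borel_measurable_def)
    show "AE x in lborel. x \<in> {0<..} \<longrightarrow> norm (E x) \<le> norm (inverse r0 * (\<rho> x * E x))"
    proof (intro AE_I2 impI)
      fix x
      have "r0 * E x \<le> \<rho> x * E x" using b(1) E_pos[of x] by (intro mult_right_mono) auto
      moreover have "0 \<le> \<rho> x" using b(1)[of x] r0 by linarith
      ultimately show "norm (E x) \<le> norm (inverse r0 * (\<rho> x * E x))"
        using r0 E_pos[of x] by (simp add: field_simps)
    qed
  qed
  have "1 \<le> (LBINT x:{0<..}. R * E x)"
    unfolding \<rho>E(2)[symmetric]
  proof (rule set_integral_mono[OF \<rho>E(1)])
    show "set_integrable lborel {0<..} (\<lambda>x. R * E x)" using E_int by simp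
    show "\<rho> x * E x \<le> R * E x" for x by (intro mult_right_mono b(2) less_imp_le E_pos)
  qed
  then have "0 < R * (LBINT x:{0<..}. E x)" by simp
  then show "0 < (LBINT x:{0<..}. E x)" using R by (simp add: zero_less_mult_iff)
qed

text \<open>
Positivity of \<open>Ibar\<close> needs the integral in its definition to converge, since an inverse of \<open>0\<close>
is \<open>0\<close>.
\<close>

lemma steady_state_renewal:
  assumes ss: "steady_state r R nbar Ibar" and r0: "0 < r0"
    and \<rho>: "\<rho> \<in> borel_measurable borel" "\<And>x. r0 \<le> \<rho> x" "\<And>x. \<rho> x \<le> R"
    and \<rho>_eq: "AE x in lborel. x \<in> {0<..} \<longrightarrow> r x Ibar = \<rho> x"
  defines "E \<equiv> \<lambda>x. exp (- (LBINT y:{0..x}. \<rho> y))"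
  shows "0 < Ibar" and "\<And>x. 0 < x \<Longrightarrow> nbar x = Ibar * E x"
    and "integrable (lebesgue_on {0<..}) nbar" and "(LINT x|lebesgue_on {0<..}. nbar x) = 1"
    and "(LINT x|lebesgue_on {0<..}. \<rho> x * nbar x) = Ibar"
proof -
  have surv: "E \<in> borel_measurable borel" "set_integrable lborel {0<..} E"
    "0 < (LBINT x:{0<..}. E x)" "(LBINT x:{0<..}. \<rho> x * E x) = 1"
    unfolding E_def using survival_integrals[OF \<rho>(1) r0 \<rho>(2,3)] by blast+
  have cum: "cum_rate r x Ibar = (LBINT y:{0..x}. \<rho> y)" for x
    unfolding cum_rate_def
    by (rule set_integral_lebesgue_eq_lborel[OF \<rho>(1)])
      (use \<rho>_eq AE_lborel_singleton[of "0::real"] in \<open>auto elim: eventually_elim2\<close>)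
  have "Ibar = inverse (LINT x:{0<..}|lebesgue. E x)"
    using ss unfolding steady_state_def cum E_def by blast
  also have "(LINT x:{0<..}|lebesgue. E x) = (LBINT x:{0<..}. E x)"
    by (rule set_integral_lebesgue_eq_lborel[OF surv(1)]) auto
  finally have Ibar: "Ibar = inverse (LBINT x:{0<..}. E x)" .
  then show Ibar_pos: "0 < Ibar" using surv(3) by simp
  show nbar: "nbar x = Ibar * E x" if "0 < x" for x
    using ss that unfolding steady_state_def cum E_def by blast
  have conv: "(LINT x|lebesgue_on {0<..}. h x * nbar x) = Ibar * (LBINT x:{0<..}. h x * E x)"
    if "h \<in> borel_measurable borel" for h
  proof -
    have m: "(\<lambda>x. Ibar * (h x * E x)) \<in> borel_measurable borel" using that surv(1) by measurable
    have "(LINT x|lebesgue_on {0<..}. h x * nbar x) = (LINT x:{0<..}|lebesgue. h x * nbar x)"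
      by (simp add: integral_restrict_space set_lebesgue_integral_def)
    also have "\<dots> = (LBINT x:{0<..}. Ibar * (h x * E x))"
      by (rule set_integral_lebesgue_eq_lborel[OF m]) (auto simp: nbar)
    finally show ?thesis by simp
  qed
  show "(LINT x|lebesgue_on {0<..}. nbar x) = 1"
    using conv[of "\<lambda>_. 1"] Ibar Ibar_pos surv(3) by simp
  show "(LINT x|lebesgue_on {0<..}. \<rho> x * nbar x) = Ibar"
    using conv[OF \<rho>(1)] surv(4) by simp
  have "set_integrable lborel {0<..} (\<lambda>x. Ibar * E x)" using surv(2) by simp
  then have "set_integrable lebesgue {0<..} (\<lambda>x. Ibar * E x)"
    unfolding set_integrable_def by (subst integrable_completion) (auto simp: borel_measurable_integrable)
  then have "set_integrable lebesgue {0<..} nbar"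
    by (rule set_integrable_cong[THEN iffD1, rotated -1]) (auto simp: nbar)
  then show "integrable (lebesgue_on {0<..}) nbar"
    by (simp add: integrable_restrict_space set_integrable_def)
qed

section \<open>Estimates for solutions of the delayed equation\<close>

text \<open>
\<open>w\<close> is the mass of \<open>n t\<close> outside the coupled part \<open>W t\<close>. The initial population is left
uncoupled, which costs only the term \<open>exp (- r\<^sub>0 * t)\<close>. The activity enters the estimates at
individual times, so \<open>I\<close> itself appears in the conclusion, and its Borel representative \<open>I'\<close> is
confined to integrals in time.
\<close>

lemma delayed_solution_estimates:
  assumes r_meas: "\<forall>I\<in>{0..r\<^sub>M}. (\<lambda>x. r x I) \<in> borel_measurable (lebesgue_on {0<..})"
    and r_upper: "\<And>x I. 0 < x \<Longrightarrow> I \<in> {0..r\<^sub>M} \<Longrightarrow> r x I \<le> r\<^sub>M"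
    and r0: "0 < r\<^sub>0" and r_lower: "\<And>x I. 0 < x \<Longrightarrow> I \<in> {0..r\<^sub>M} \<Longrightarrow> r\<^sub>0 \<le> r x I"
    and lip: "AE x in lborel. 0 < x \<longrightarrow> (\<forall>I\<in>{0..r\<^sub>M}. \<forall>J\<in>{0..r\<^sub>M}. \<bar>r x I - r x J\<bar> \<le> \<gamma> * \<bar>I - J\<bar>)"
    and \<gamma>: "0 \<le> \<gamma>" and d: "0 < d"
    and sol: "delayed_solution r r\<^sub>M d n_ini I_ini n I" and ss: "steady_state r r\<^sub>M nbar Ibar" and t: "0 \<le> t"
  obtains w where "L1_norm (\<lambda>x. n t x - nbar x) \<le> 2 * w"
    and "\<bar>I t - Ibar\<bar> \<le> \<gamma> * \<bar>I (t - d) - Ibar\<bar> + r\<^sub>M * w"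
    and "w \<le> exp (- r\<^sub>0 * t) + 2 * (LINT s:{0..t}|lebesgue. \<gamma> * \<bar>I (s - d) - Ibar\<bar> * exp (- r\<^sub>0 * (t - s)))"
proof -
  let ?\<Lambda> = "lebesgue_on {0::real<..}"
  have Ibar: "Ibar \<in> {0..r\<^sub>M}" using ss by (simp add: steady_state_def)
  have r0_le: "r\<^sub>0 \<le> r\<^sub>M" using r_lower[of 1 Ibar] r_upper[of 1 Ibar] Ibar by auto
  have rM: "0 \<le> r\<^sub>M" using r0 r0_le by linarith
  have I_range: "I s \<in> {0..r\<^sub>M}" if "- d \<le> s" for s
    using sol that unfolding delayed_solution_def by blast
  have I_meas: "I \<in> borel_measurable (lebesgue_on {-d..})" using sol unfolding delayed_solution_def by blast
  have I_eq: "I s = (LINT x:{0<..}|lebesgue. r x (I (s - d)) * n s x)" if "0 \<le> s" for s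
    using sol that unfolding delayed_solution_def by blast
  have dens: "prob_density (n s)" if "0 \<le> s" for s
    using sol that unfolding delayed_solution_def by blast
  have "\<exists>g\<in>borel_measurable borel. (\<forall>x. r\<^sub>0 \<le> g x \<and> g x \<le> r\<^sub>M) \<and> (AE x in lborel. x \<in> {0<..} \<longrightarrow> r x Ibar = g x)"
    by (rule bounded_borel_representative) (use r_meas r_lower r_upper Ibar r0_le in auto)
  then obtain \<rho> where \<rho>: "\<rho> \<in> borel_measurable borel" "\<And>x. r\<^sub>0 \<le> \<rho> x" "\<And>x. \<rho> x \<le> r\<^sub>M"
    "AE x in lborel. x \<in> {0<..} \<longrightarrow> r x Ibar = \<rho> x"
    by blast
  have "\<exists>g\<in>borel_measurable borel. (\<forall>s. 0 \<le> g s \<and> g s \<le> r\<^sub>M) \<and> (AE s in lborel. s \<in> {-d..} \<longrightarrow> I s = g s)"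
    by (rule bounded_borel_representative[OF I_meas]) (use I_range rM in auto)
  then obtain I' where I': "I' \<in> borel_measurable borel" "\<And>s. 0 \<le> I' s" "\<And>s. I' s \<le> r\<^sub>M"
    "AE s in lborel. s \<in> {-d..} \<longrightarrow> I s = I' s"
    by blast
  have [measurable]: "\<rho> \<in> borel_measurable borel" "I' \<in> borel_measurable borel" by fact+
  define q where "q = (\<lambda>s. \<gamma> * \<bar>I' (s - d) - Ibar\<bar>)"
  have q_meas [measurable]: "q \<in> borel_measurable borel" unfolding q_def by measurable
  have q_nonneg: "0 \<le> q s" for s using \<gamma> by (simp add: q_def)
  have q_le: "q s \<le> \<gamma> * r\<^sub>M" for s
    unfolding q_def using \<gamma> I'(2,3)[of "s - d"] Ibar by (intro mult_left_mono) auto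
  have q_abs: "\<bar>q s\<bar> \<le> \<gamma> * r\<^sub>M" for s using q_le[of s] q_nonneg[of s] by simp
  have \<rho>_abs: "\<bar>\<rho> x\<bar> \<le> r\<^sub>M" for x using \<rho>(2,3)[of x] r0 by auto
  define D where "D = (\<lambda>s. LBINT u:{0..s}. q u)"
  define E where "E = (\<lambda>x. exp (- (LBINT y:{0..x}. \<rho> y)))"
  define \<kappa> where "\<kappa> = (\<lambda>s. min (I' s) Ibar)"
  have D_meas [measurable]: "D \<in> borel_measurable borel"
    unfolding D_def by (rule borel_measurable_indefinite_integral[OF q_meas q_abs])
  have E_meas [measurable]: "E \<in> borel_measurable borel"
    unfolding E_def using borel_measurable_indefinite_integral[OF \<rho>(1) \<rho>_abs] by measurable
  have E_pos: "0 < E x" for x by (simp add: E_def)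
  have \<kappa>_meas [measurable]: "\<kappa> \<in> borel_measurable borel" unfolding \<kappa>_def by measurable
  have \<kappa>_bounds: "0 \<le> \<kappa> s" "\<kappa> s \<le> Ibar" for s unfolding \<kappa>_def using I'(2)[of s] Ibar by auto
  have D_diff: "D s - D u = (LBINT v:{u..s}. q v)" if "0 \<le> u" "u \<le> s" for s u
  proof -
    have "(LBINT v:{u..s}. q v) = (LBINT v:{u<..s}. q v)"
      unfolding set_lebesgue_integral_def
      by (rule integral_cong_AE) (auto simp: indicator_def intro!: eventually_mono[OF AE_lborel_singleton[of u]])
    then show ?thesis unfolding D_def using set_integral_Icc_split[OF q_meas that, of "\<gamma> * r\<^sub>M"] q_abs by simp
  qed
  have D_mono: "D u \<le> D s" if "0 \<le> u" "u \<le> s" for s u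
  proof -
    have "0 \<le> (LBINT v:{u..s}. q v)"
      unfolding set_lebesgue_integral_def using q_nonneg by (intro Bochner_Integration.integral_nonneg) auto
    then show ?thesis using D_diff[OF that] by linarith
  qed
  have steady: "0 < Ibar" "\<And>x. 0 < x \<Longrightarrow> nbar x = Ibar * E x" "integrable ?\<Lambda> nbar"
    "(LINT x|?\<Lambda>. nbar x) = 1" "(LINT x|?\<Lambda>. \<rho> x * nbar x) = Ibar"
    unfolding E_def using steady_state_renewal[OF ss r0 \<rho>] by blast+
  \<comment> \<open>\<open>exp (- D s) * exp (D (s - x))\<close> damps a neuron of age \<open>x\<close> by the rate \<open>q\<close> since its birth at time \<open>s - x\<close>\<close>
  define W where "W = (\<lambda>s x. indicator {0..s} x * (exp (- D s) * (E x * (exp (D (s - x)) * \<kappa> (s - x)))))"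
  have W_meas: "W s \<in> borel_measurable borel" for s unfolding W_def by measurable
  have W_nonneg: "0 \<le> W s x" for s x unfolding W_def using \<kappa>_bounds(1) E_pos by (simp add: less_imp_le)
  have conv: "(LINT x|?\<Lambda>. h x * W s x) = exp (- D s) * (LBINT b:{0..s}. h (s - b) * (E (s - b) * (exp (D b) * \<kappa> b)))"
    if [measurable]: "h \<in> borel_measurable borel" for h s
  proof -
    have m: "(\<lambda>x. h x * W s x) \<in> borel_measurable borel" using W_meas by measurable
    have "(LINT x|?\<Lambda>. h x * W s x) = (LINT x:{0<..}|lebesgue. h x * W s x)"
      by (simp add: integral_restrict_space set_lebesgue_integral_def)
    also have "\<dots> = (LBINT x:{0<..}. h x * W s x)"
      by (rule set_integral_lebesgue_eq_lborel[OF m]) auto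
    also have "\<dots> = (LBINT x:{0..s}. exp (- D s) * (h x * (E x * (exp (D (s - x)) * \<kappa> (s - x)))))"
      unfolding set_lebesgue_integral_def
    proof (rule integral_cong_AE)
      show "AE x in lborel. indicator {0<..} x *\<^sub>R (h x * W s x) =
          indicator {0..s} x *\<^sub>R (exp (- D s) * (h x * (E x * (exp (D (s - x)) * \<kappa> (s - x)))))"
        using AE_lborel_singleton[of 0] by eventually_elim (auto simp: W_def indicator_def)
    qed (use m in measurable)
    also have "\<dots> = exp (- D s) * (LBINT x:{0..s}. h x * (E x * (exp (D (s - x)) * \<kappa> (s - x))))"
      by simp
    also have "(LBINT x:{0..s}. h x * (E x * (exp (D (s - x)) * \<kappa> (s - x)))) =
        (LBINT b:{0..s}. h (s - b) * (E (s - b) * (exp (D b) * \<kappa> b)))"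
      using set_integral_reflect_Icc[of s "\<lambda>x. h x * (E x * (exp (D (s - x)) * \<kappa> (s - x)))"] by simp
    finally show ?thesis .
  qed
  have W_le_n: "AE x in lborel. 0 < x \<longrightarrow> W s x \<le> n s x" if s: "0 \<le> s" for s
  proof -
    have a1: "AE x in lborel. x > 0 \<longrightarrow>
        n s x = (if x \<ge> s then n_ini (x - s) * exp (- (LINT u:{0..s}|lebesgue. r (x - s + u) (I (u - d))))
          else I (s - x) * exp (- (LINT u:{0..x}|lebesgue. r u (I (s - x + u - d)))))"
      using sol s unfolding delayed_solution_def AE_completion_iff by blast
    have a2: "AE x in lborel. x > 0 \<longrightarrow> 0 \<le> n s x"
      using dens[OF s] unfolding prob_density_def AE_completion_iff by blast
    have a4: "AE x in lborel. s + (- 1) * x \<in> {-d..} \<longrightarrow> I (s + (- 1) * x) = I' (s + (- 1) * x)"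
      by (rule AE_lborel_affine[OF I'(4)]) simp
    show ?thesis
      using a1 a2 AE_lborel_singleton[of s] a4
    proof eventually_elim
      case (elim x)
      show ?case
      proof
        assume x: "0 < x"
        show "W s x \<le> n s x"
        proof (cases "x < s")
          case False
          then show ?thesis using elim x by (simp add: W_def indicator_def)
        next
          case True
          define L where "L = (LINT u:{0..x}|lebesgue. r u (I (s - x + u - d)))"
          define f where "f = (\<lambda>u. \<rho> u + q (s - x + u))"
          have f_meas [measurable]: "f \<in> borel_measurable borel" unfolding f_def by measurable
          have f_int: "set_integrable lborel {0..x} \<rho>" "set_integrable lborel {0..x} (\<lambda>u. q (s - x + u))"
            by (rule set_integrable_bounded_Icc[where a=0 and b=x and K="r\<^sub>M"], use \<rho>_abs in auto)
              (rule set_integrable_bounded_Icc[where a=0 and b=x and K="\<gamma> * r\<^sub>M"], use q_abs in auto)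
          \<comment> \<open>along the characteristic the true rate exceeds \<open>\<rho>\<close> by at most \<open>q\<close>\<close>
          have "L \<le> (LINT u:{0..x}|lebesgue. f u)"
            unfolding L_def set_lebesgue_integral_def
          proof (rule integral_mono_AE')
            have "set_integrable lborel {0..x} f" unfolding f_def by (rule set_integral_add(1)[OF f_int])
            then show "integrable lebesgue (\<lambda>u. indicator {0..x} u *\<^sub>R f u)"
              unfolding set_integrable_def by (subst integrable_completion) auto
            show "AE u in lebesgue. 0 \<le> indicator {0..x} u *\<^sub>R f u"
            proof (intro AE_I2)
              fix u
              have "0 \<le> \<rho> u" using \<rho>(2)[of u] r0 by linarith
              then show "0 \<le> indicator {0..x} u *\<^sub>R f u" using q_nonneg[of "s - x + u"] by (simp add: f_def)
            qed
            have b1: "AE u in lborel. (s - x - d) + 1 * u \<in> {-d..} \<longrightarrow> I ((s - x - d) + 1 * u) = I' ((s - x - d) + 1 * u)"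
              by (rule AE_lborel_affine[OF I'(4)]) simp
            have "AE u in lborel. indicator {0..x} u *\<^sub>R r u (I (s - x + u - d)) \<le> indicator {0..x} u *\<^sub>R f u"
              using b1 lip \<rho>(4) AE_lborel_singleton[of 0]
            proof eventually_elim
              case (elim u)
              show ?case
              proof (cases "u \<in> {0..x}")
                case u: True
                then have u0: "0 < u" using elim(4) by auto
                define J where "J = I (s - x + u - d)"
                have J: "J \<in> {0..r\<^sub>M}" unfolding J_def using u True by (intro I_range) auto
                have J': "J = I' (s - x + u - d)" unfolding J_def using elim(1) u True by (simp add: algebra_simps)
                have "\<bar>r u J - r u Ibar\<bar> \<le> \<gamma> * \<bar>J - Ibar\<bar>" using elim(2) u0 J Ibar by blast
                moreover have "r u Ibar = \<rho> u" using elim(3) u0 by simp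
                ultimately have "r u J \<le> f u" unfolding f_def q_def J' by linarith
                then show ?thesis unfolding J_def by (intro scaleR_left_mono) auto
              qed simp
            qed
            then show "AE u in lebesgue. indicator {0..x} u *\<^sub>R r u (I (s - x + u - d)) \<le> indicator {0..x} u *\<^sub>R f u"
              by (rule AE_completion)
          qed
          also have "\<dots> = (LBINT u:{0..x}. f u)"
            by (rule set_integral_lebesgue_eq_lborel[OF f_meas]) auto
          also have "\<dots> = (LBINT u:{0..x}. \<rho> u) + (LBINT u:{0..x}. q (s - x + u))"
            unfolding f_def by (rule set_integral_add(2)[OF f_int])
          also have "(LBINT u:{0..x}. q (s - x + u)) = D s - D (s - x)"
          proof -
            have "(LBINT v:{s - x..s}. q v) = (LBINT u:{0..x}. q (s - x + u))"
              using set_integral_shift_Icc[of "s - x" s "\<lambda>u. q (s - x + u)"] by simp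
            then show ?thesis using D_diff[of "s - x" s] x True by simp
          qed
          finally have "exp (- ((LBINT u:{0..x}. \<rho> u) + (D s - D (s - x)))) \<le> exp (- L)" by simp
          moreover have "\<kappa> (s - x) \<le> I (s - x)"
            using elim(4) True d by (auto simp: \<kappa>_def)
          ultimately have "\<kappa> (s - x) * exp (- ((LBINT u:{0..x}. \<rho> u) + (D s - D (s - x)))) \<le> I (s - x) * exp (- L)"
            using \<kappa>_bounds(1)[of "s - x"] by (intro mult_mono) auto
          moreover have "W s x = \<kappa> (s - x) * exp (- ((LBINT u:{0..x}. \<rho> u) + (D s - D (s - x))))"
            using x True by (simp add: W_def E_def exp_minus exp_add exp_diff field_simps)
          moreover have "n s x = I (s - x) * exp (- L)"
            using elim(1) x True by (simp add: L_def)
          ultimately show ?thesis by simp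
        qed
      qed
    qed
  qed
  have W_le_nbar: "W s x \<le> nbar x" if s: "0 \<le> s" and x: "0 < x" for s x
  proof (cases "x \<le> s")
    case True
    have "exp (- D s) * exp (D (s - x)) \<le> 1"
      using D_mono[of "s - x" s] x True by (simp flip: exp_add)
    then have "(exp (- D s) * exp (D (s - x))) * \<kappa> (s - x) \<le> 1 * Ibar"
      using \<kappa>_bounds[of "s - x"] by (intro mult_mono) auto
    then have "((exp (- D s) * exp (D (s - x))) * \<kappa> (s - x)) * E x \<le> Ibar * E x"
      using E_pos[of x] by (intro mult_right_mono) auto
    then show ?thesis using True x by (simp add: W_def steady(2) mult_ac)
  next
    case False
    then show ?thesis using E_pos[of x] steady(1) x by (simp add: W_def steady(2))
  qed
  have restrict: "(AE x in ?\<Lambda>. P x) \<longleftrightarrow> (AE x in lborel. 0 < x \<longrightarrow> P x)" for P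
    by (subst AE_restrict_space_iff) (auto simp: AE_completion_iff)
  have borel_\<Lambda>: "h \<in> borel_measurable ?\<Lambda>" if "h \<in> borel_measurable borel" for h :: "real \<Rightarrow> real"
    using that by (intro measurable_restrict_space1 measurable_completion) simp
  have part: "integral\<^sup>L ?\<Lambda> (W s) \<le> 1"
      "(LINT x|?\<Lambda>. \<bar>n s x - nbar x\<bar>) \<le> 2 * (1 - integral\<^sup>L ?\<Lambda> (W s))"
      "r\<^sub>0 + (LINT x|?\<Lambda>. (\<rho> x - \<gamma> * \<bar>I (s - d) - Ibar\<bar> - r\<^sub>0) * W s x) \<le> I s"
      "r\<^sub>0 + (LINT x|?\<Lambda>. (\<rho> x - \<gamma> * \<bar>I (s - d) - Ibar\<bar> - r\<^sub>0) * W s x) \<le> Ibar"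
      "\<bar>I s - Ibar\<bar> \<le> \<gamma> * \<bar>I (s - d) - Ibar\<bar> + r\<^sub>M * (1 - integral\<^sup>L ?\<Lambda> (W s))"
    if s: "0 \<le> s" for s
  proof -
    have J: "I (s - d) \<in> {0..r\<^sub>M}" using s by (intro I_range) simp
    have n_int: "integrable ?\<Lambda> (n s)" "integral\<^sup>L ?\<Lambda> (n s) = 1"
      using dens[OF s] by (auto simp: prob_density_def set_integrable_def set_lebesgue_integral_def
        integrable_restrict_space integral_restrict_space)
    have W: "AE x in ?\<Lambda>. 0 \<le> W s x \<and> W s x \<le> n s x \<and> W s x \<le> nbar x"
      unfolding restrict using W_le_n[OF s] by eventually_elim (use W_nonneg W_le_nbar[OF s] in auto)
    have rates: "AE x in ?\<Lambda>. r\<^sub>0 \<le> r x (I (s - d)) \<and> r x (I (s - d)) \<le> r\<^sub>M \<and> r\<^sub>0 \<le> \<rho> x \<and> \<rho> x \<le> r\<^sub>M \<and>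
        \<bar>r x (I (s - d)) - \<rho> x\<bar> \<le> \<gamma> * \<bar>I (s - d) - Ibar\<bar>"
      unfolding restrict using lip \<rho>(4)
    proof eventually_elim
      case (elim x)
      show ?case
      proof
        assume x: "0 < x"
        have "\<bar>r x (I (s - d)) - r x Ibar\<bar> \<le> \<gamma> * \<bar>I (s - d) - Ibar\<bar>" using elim(1) x J Ibar by blast
        moreover have "r x Ibar = \<rho> x" using elim(2) x by simp
        ultimately show "r\<^sub>0 \<le> r x (I (s - d)) \<and> r x (I (s - d)) \<le> r\<^sub>M \<and> r\<^sub>0 \<le> \<rho> x \<and> \<rho> x \<le> r\<^sub>M \<and>
            \<bar>r x (I (s - d)) - \<rho> x\<bar> \<le> \<gamma> * \<bar>I (s - d) - Ibar\<bar>"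
          using r_lower[OF x J] r_upper[OF x J] \<rho>(2,3)[of x] by simp
      qed
    qed
    have Is: "I s = (LINT x|?\<Lambda>. r x (I (s - d)) * n s x)"
      by (subst I_eq[OF s]) (simp add: integral_restrict_space set_lebesgue_integral_def)
    note cp = common_part_estimates[OF n_int(1) steady(3) borel_\<Lambda>[OF W_meas] n_int(2) steady(4)
        bspec[OF r_meas J] borel_\<Lambda>[OF \<rho>(1)] W rates]
    show "integral\<^sup>L ?\<Lambda> (W s) \<le> 1"
      "(LINT x|?\<Lambda>. \<bar>n s x - nbar x\<bar>) \<le> 2 * (1 - integral\<^sup>L ?\<Lambda> (W s))"
      "r\<^sub>0 + (LINT x|?\<Lambda>. (\<rho> x - \<gamma> * \<bar>I (s - d) - Ibar\<bar> - r\<^sub>0) * W s x) \<le> I s"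
      "r\<^sub>0 + (LINT x|?\<Lambda>. (\<rho> x - \<gamma> * \<bar>I (s - d) - Ibar\<bar> - r\<^sub>0) * W s x) \<le> Ibar"
      "\<bar>I s - Ibar\<bar> \<le> \<gamma> * \<bar>I (s - d) - Ibar\<bar> + r\<^sub>M * (1 - integral\<^sup>L ?\<Lambda> (W s))"
      using cp(3-7) r0 r0_le \<gamma> unfolding Is[symmetric] steady(5) by auto
  qed
  have mass: "integral\<^sup>L ?\<Lambda> (W s) = exp (- D s) * (LBINT b:{0..s}. E (s - b) * (exp (D b) * \<kappa> b))" for s
    using conv[of "\<lambda>_. 1" s] by simp
  have exp_cancel: "exp (D s) * (exp (- D s) * z) = z" for s z
    by (simp add: exp_minus)
  have "1 - exp (- D t) * (LBINT b:{0..t}. E (t - b) * (exp (D b) * \<kappa> b))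
      \<le> exp (- r\<^sub>0 * t) + 2 * (LBINT s:{0..t}. q s * exp (- r\<^sub>0 * (t - s)))"
    unfolding D_def E_def
  proof (rule renewed_overlap_lower_bound[OF \<rho>(1) \<rho>_abs q_meas q_nonneg q_le \<kappa>_meas \<kappa>_bounds t];
      (fold D_def)?, (fold E_def)?)
    show "0 \<le> r\<^sub>0" using r0 by simp
    fix s assume "s \<in> {0..t}"
    then have "exp (- D s) * (LBINT b:{0..s}. E (s - b) * (exp (D b) * \<kappa> b)) \<le> 1"
      using part(1)[of s] mass[of s] by simp
    from mult_left_mono[OF this exp_ge_zero, of "D s"]
    have "(LBINT b:{0..s}. E (s - b) * (exp (D b) * \<kappa> b)) \<le> exp (D s)"
      by (simp only: exp_cancel mult_1_right)
    then show "(LBINT b:{0..s}. exp (- (LBINT y:{0..s - b}. \<rho> y)) * (exp (LBINT u:{0..b}. q u) * \<kappa> b)) \<le> exp (LBINT u:{0..s}. q u)"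
      unfolding D_def E_def .
  next
    have c1: "AE s in lborel. (- d) + 1 * s \<in> {-d..} \<longrightarrow> I ((- d) + 1 * s) = I' ((- d) + 1 * s)"
      by (rule AE_lborel_affine[OF I'(4)]) simp
    have "AE s in lborel. s \<in> {0..t} \<longrightarrow>
        r\<^sub>0 * exp (D s) + (LBINT b:{0..s}. (\<rho> (s - b) - q s - r\<^sub>0) * (E (s - b) * (exp (D b) * \<kappa> b)))
          \<le> exp (D s) * \<kappa> s"
      using c1 I'(4)
    proof eventually_elim
      case (elim s)
      show ?case
      proof
        assume s: "s \<in> {0..t}"
        have q_eq: "\<gamma> * \<bar>I (s - d) - Ibar\<bar> = q s" using elim(1) s by (simp add: q_def)
        have "I s = I' s" using elim(2) s d by simp
        then have "r\<^sub>0 + (LINT x|?\<Lambda>. (\<rho> x - q s - r\<^sub>0) * W s x) \<le> \<kappa> s"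
          using part(3,4)[of s] s unfolding q_eq \<kappa>_def by simp
        then have "r\<^sub>0 + exp (- D s) * (LBINT b:{0..s}. (\<rho> (s - b) - q s - r\<^sub>0) * (E (s - b) * (exp (D b) * \<kappa> b))) \<le> \<kappa> s"
          using conv[of "\<lambda>x. \<rho> x - q s - r\<^sub>0" s] by simp
        from mult_left_mono[OF this exp_ge_zero, of "D s"]
        show "r\<^sub>0 * exp (D s) + (LBINT b:{0..s}. (\<rho> (s - b) - q s - r\<^sub>0) * (E (s - b) * (exp (D b) * \<kappa> b)))
          \<le> exp (D s) * \<kappa> s"
          by (simp only: distrib_left exp_cancel mult.commute[of "r\<^sub>0"])
      qed
    qed
    then show "AE s in lborel. s \<in> {0..t} \<longrightarrow>
        r\<^sub>0 * exp (LBINT u:{0..s}. q u) + (LBINT b:{0..s}. (\<rho> (s - b) - q s - r\<^sub>0) * (exp (- (LBINT y:{0..s - b}. \<rho> y)) * (exp (LBINT u:{0..b}. q u) * \<kappa> b)))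
          \<le> exp (LBINT u:{0..s}. q u) * \<kappa> s"
      unfolding D_def E_def .
  qed
  moreover have "(LBINT s:{0..t}. q s * exp (- r\<^sub>0 * (t - s))) =
      (LINT s:{0..t}|lebesgue. \<gamma> * \<bar>I (s - d) - Ibar\<bar> * exp (- r\<^sub>0 * (t - s)))"
  proof (rule set_integral_lebesgue_eq_lborel[symmetric])
    have c1: "AE s in lborel. (- d) + 1 * s \<in> {-d..} \<longrightarrow> I ((- d) + 1 * s) = I' ((- d) + 1 * s)"
      by (rule AE_lborel_affine[OF I'(4)]) simp
    then show "AE s in lborel. s \<in> {0..t} \<longrightarrow> \<gamma> * \<bar>I (s - d) - Ibar\<bar> * exp (- r\<^sub>0 * (t - s)) = q s * exp (- r\<^sub>0 * (t - s))"
      by eventually_elim (auto simp: q_def)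
  qed measurable
  ultimately have "1 - integral\<^sup>L ?\<Lambda> (W t) \<le> exp (- r\<^sub>0 * t) +
      2 * (LINT s:{0..t}|lebesgue. \<gamma> * \<bar>I (s - d) - Ibar\<bar> * exp (- r\<^sub>0 * (t - s)))"
    using mass[of t] by simp
  moreover have "L1_norm (\<lambda>x. n t x - nbar x) \<le> 2 * (1 - integral\<^sup>L ?\<Lambda> (W t))"
    using part(2)[OF t] by (simp add: L1_norm_def integral_restrict_space set_lebesgue_integral_def)
  ultimately show ?thesis using part(5)[OF t] that by blast
qed

section \<open>Exponential convergence\<close>

text \<open>
Both conditions are strict at \<open>l = 0\<close>. The constant \<open>8 / 3\<close> is \<open>2 * (4 / 3)\<close>: the error term of
the coupling counts \<open>q\<close> twice, and the bound propagated for the activity carries \<open>4 / 3\<close>.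
\<close>

lemma small_decay_rate_exists:
  fixes \<gamma> R r0 d :: real
  assumes "4 * \<gamma> < 1" "3 * \<gamma> * R < r0" "0 < \<gamma>" "0 < R"
  obtains l where "0 < l" "4 * \<gamma> * exp (l * d) \<le> 1" "8 / 3 * \<gamma> * R * exp (l * d) \<le> r0 - l" "l < r0"
proof -
  have "((\<lambda>l. 4 * \<gamma> * exp (l * d)) \<longlongrightarrow> 4 * \<gamma> * exp (0 * d)) (at_right 0)"
    by (intro tendsto_intros)
  then have 1: "\<forall>\<^sub>F l in at_right 0. 4 * \<gamma> * exp (l * d) < 1"
    using assms(1) by (intro order_tendstoD) auto
  have "((\<lambda>l. 8 / 3 * \<gamma> * R * exp (l * d) + l) \<longlongrightarrow> 8 / 3 * \<gamma> * R * exp (0 * d) + 0) (at_right 0)"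
    by (intro tendsto_intros)
  moreover have "8 / 3 * \<gamma> * R * exp (0 * d) + 0 < r0"
  proof -
    have "8 / 3 * \<gamma> * R * exp (0 * d) + 0 = 8 / 3 * (\<gamma> * R)" by simp
    then show ?thesis using assms(2) mult_pos_pos[OF assms(3,4)] by linarith
  qed
  ultimately have 2: "\<forall>\<^sub>F l in at_right 0. 8 / 3 * \<gamma> * R * exp (l * d) + l < r0"
    by (rule order_tendstoD(2))
  have "\<exists>l. 4 * \<gamma> * exp (l * d) < 1 \<and> 8 / 3 * \<gamma> * R * exp (l * d) + l < r0 \<and> 0 < l"
    using eventually_conj[OF 1 eventually_conj[OF 2 eventually_at_right_less[of 0]]]
    by (rule eventually_happens'[rotated]) simp
  then obtain l where l: "4 * \<gamma> * exp (l * d) < 1" "8 / 3 * \<gamma> * R * exp (l * d) + l < r0" "0 < l" by blast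
  moreover have "0 < 8 / 3 * \<gamma> * R * exp (l * d)" using assms by simp
  ultimately show ?thesis by (intro that[of l]) linarith+
qed

lemma delayed_convolution_le:
  fixes h :: "real \<Rightarrow> real"
  assumes h: "\<And>u. u \<in> {- d..t - d} \<Longrightarrow> h u \<le> B * exp (- l * u)"
    and nonneg: "0 \<le> \<gamma>" "0 \<le> B" and l: "l < r0" and t: "0 \<le> t"
  shows "(LINT s:{0..t}|lebesgue. \<gamma> * h (s - d) * exp (- r0 * (t - s)))
      \<le> \<gamma> * B * exp (l * d) * ((exp (- l * t) - exp (- r0 * t)) / (r0 - l))"
proof -
  define c where "c = \<gamma> * B * exp (l * d) * exp (- r0 * t)"
  have c: "0 \<le> c" using nonneg by (simp add: c_def)
  define f where "f = (\<lambda>s. c * exp ((r0 - l) * s))"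
  have f_cont: "continuous_on UNIV f" unfolding f_def by (intro continuous_intros)
  have f_meas: "f \<in> borel_measurable borel" by (rule borel_measurable_continuous_onI[OF f_cont])
  have f_int: "set_integrable lborel {0..t} f"
    by (rule borel_integrable_atLeastAtMost'[OF continuous_on_subset[OF f_cont]]) simp
  have "(LINT s:{0..t}|lebesgue. \<gamma> * h (s - d) * exp (- r0 * (t - s))) \<le> (LINT s:{0..t}|lebesgue. f s)"
    unfolding set_lebesgue_integral_def
  proof (rule integral_mono_AE')
    show "integrable lebesgue (\<lambda>s. indicator {0..t} s *\<^sub>R f s)"
      using f_int f_meas unfolding set_integrable_def by (subst integrable_completion) auto
    show "AE s in lebesgue. 0 \<le> indicator {0..t} s *\<^sub>R f s" using c by (simp add: f_def)
    show "AE s in lebesgue. indicator {0..t} s *\<^sub>R (\<gamma> * h (s - d) * exp (- r0 * (t - s))) \<le> indicator {0..t} s *\<^sub>R f s"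
    proof (intro AE_I2)
      fix s
      show "indicator {0..t} s *\<^sub>R (\<gamma> * h (s - d) * exp (- r0 * (t - s))) \<le> indicator {0..t} s *\<^sub>R f s"
      proof (cases "s \<in> {0..t}")
        case True
        have "\<gamma> * h (s - d) * exp (- r0 * (t - s)) \<le> \<gamma> * (B * exp (- l * (s - d))) * exp (- r0 * (t - s))"
          using True nonneg by (intro mult_right_mono mult_left_mono h) auto
        also have "\<dots> = f s" by (simp add: f_def c_def algebra_simps flip: exp_add)
        finally show ?thesis using True by simp
      qed simp
    qed
  qed
  also have "\<dots> = (LBINT s:{0..t}. f s)"
    by (rule set_integral_lebesgue_eq_lborel[OF f_meas]) auto
  also have "\<dots> = c * exp ((r0 - l) * t) / (r0 - l) - c * exp ((r0 - l) * 0) / (r0 - l)"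
  proof -
    have "(LBINT s. f s * indicator {0..t} s) = c * exp ((r0 - l) * t) / (r0 - l) - c * exp ((r0 - l) * 0) / (r0 - l)"
    proof (rule integral_FTC_Icc_real[OF t])
      fix s
      show "((\<lambda>s. c * exp ((r0 - l) * s) / (r0 - l)) has_field_derivative f s) (at s)"
        using l by (auto simp: f_def intro!: derivative_eq_intros)
      show "isCont f s" using f_cont by (simp add: continuous_on_eq_continuous_at)
    qed
    then show ?thesis by (simp add: set_lebesgue_integral_def mult.commute)
  qed
  also have "\<dots> = \<gamma> * B * exp (l * d) * ((exp (- r0 * t) * exp ((r0 - l) * t) - exp (- r0 * t)) / (r0 - l))"
    by (simp add: c_def diff_divide_distrib right_diff_distrib mult.assoc)
  also have "exp (- r0 * t) * exp ((r0 - l) * t) = exp (- l * t)"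
    by (simp add: algebra_simps flip: exp_add)
  finally show ?thesis .
qed

theorem theorem3p2:
  fixes r :: "real \<Rightarrow> real \<Rightarrow> real" and dr :: "real \<times> real \<Rightarrow> real"
    and r\<^sub>M r\<^sub>0 d \<gamma> :: real
  assumes "r\<^sub>M > 0"
    and r_meas: "\<forall>I\<in>{0..r\<^sub>M}. (\<lambda>x. r x I) \<in> borel_measurable (lebesgue_on {0<..})"
    and r_bounds: "\<forall>x>0. \<forall>I\<in>{0..r\<^sub>M}. 0 \<le> r x I \<and> r x I \<le> r\<^sub>M"
    and r_cont: "AE x in lebesgue. x > 0 \<longrightarrow> continuous_on {0..r\<^sub>M} (r x)"
    and r_deriv: "weak_deriv_snd ({0<..} \<times> {0<..<r\<^sub>M}) r dr"
    and dr_Linf: "Linf (lebesgue_on ({0<..} \<times> {0<..<r\<^sub>M})) dr"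
    and "r\<^sub>0 > 0" and r_lower: "\<forall>x>0. \<forall>I\<in>{0..r\<^sub>M}. r x I \<ge> r\<^sub>0"
    and "d > 0"
    and gamma: "\<gamma> = Linf_norm (lebesgue_on ({0<..} \<times> {0<..<r\<^sub>M})) dr" and "\<gamma> > 0"
    and small: "omega r\<^sub>M r\<^sub>0 \<gamma> < 1"
  shows "\<exists>lam>0. \<forall>n_ini I_ini n I nbar Ibar.
           prob_density n_ini \<and> I_ini \<in> {0..r\<^sub>M} \<and>
           delayed_solution r r\<^sub>M d n_ini I_ini n I \<and>
           steady_state r r\<^sub>M nbar Ibar \<longrightarrow>
           (\<forall>t\<ge>0. \<bar>I t - Ibar\<bar> \<le> 2 * r\<^sub>M / omega r\<^sub>M r\<^sub>0 \<gamma> * exp (- lam * t) \<and>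
                  L1_norm (\<lambda>x. n t x - nbar x) \<le> 2 / omega r\<^sub>M r\<^sub>0 \<gamma> * exp (- lam * t))"
proof -
  let ?\<Omega> = "{0::real<..} \<times> {0<..<r\<^sub>M}"
  define w where "w = omega r\<^sub>M r\<^sub>0 \<gamma>"
  have r0_le: "r\<^sub>0 \<le> r\<^sub>M"
    using r_lower[rule_format, of 1 0] r_bounds[rule_format, of 1 0] \<open>r\<^sub>M > 0\<close> by auto
  have w_eq: "w = 3 * \<gamma> * r\<^sub>M / r\<^sub>0 + \<gamma>" by (simp add: w_def omega_def algebra_simps)
  have "3 * \<gamma> \<le> 3 * \<gamma> * r\<^sub>M / r\<^sub>0" using r0_le \<open>r\<^sub>0 > 0\<close> \<open>\<gamma> > 0\<close> by (simp add: field_simps)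
  then have \<gamma>4: "4 * \<gamma> < 1" and w: "0 < w" "w < 1" "3 * \<gamma> * r\<^sub>M / r\<^sub>0 < 1"
    using w_eq small \<open>\<gamma> > 0\<close> unfolding w_def[symmetric] by linarith+
  have \<gamma>3: "3 * \<gamma> * r\<^sub>M < r\<^sub>0" using w(3) \<open>r\<^sub>0 > 0\<close> by (simp add: divide_less_eq)
  have "AE z in lebesgue_on ?\<Omega>. ereal \<bar>dr z\<bar> \<le> esssup (lebesgue_on ?\<Omega>) (\<lambda>z. ereal \<bar>dr z\<bar>)"
    by (rule esssup_AE)
  moreover have "esssup (lebesgue_on ?\<Omega>) (\<lambda>z. ereal \<bar>dr z\<bar>) = ereal \<gamma>"
    using gamma \<open>\<gamma> > 0\<close> unfolding Linf_norm_def
    by (cases "esssup (lebesgue_on ?\<Omega>) (\<lambda>z. ereal \<bar>dr z\<bar>)") auto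
  ultimately have dr_le: "AE z in lebesgue_on ?\<Omega>. \<bar>dr z\<bar> \<le> \<gamma>" by simp
  have lip: "AE x in lborel. 0 < x \<longrightarrow> (\<forall>I\<in>{0..r\<^sub>M}. \<forall>J\<in>{0..r\<^sub>M}. \<bar>r x I - r x J\<bar> \<le> \<gamma> * \<bar>I - J\<bar>)"
    by (rule AE_lipschitz_if_weak_deriv_bounded[OF r_deriv dr_le _ \<open>r\<^sub>M > 0\<close> _ r_cont, of "r\<^sub>M"])
      (use \<open>\<gamma> > 0\<close> r_bounds in auto)
  obtain l where l: "0 < l" "4 * \<gamma> * exp (l * d) \<le> 1" "8 / 3 * \<gamma> * r\<^sub>M * exp (l * d) \<le> r\<^sub>0 - l" "l < r\<^sub>0"
    using small_decay_rate_exists[OF \<gamma>4 \<gamma>3 \<open>\<gamma> > 0\<close> \<open>r\<^sub>M > 0\<close>] by blast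
  \<comment> \<open>\<open>4 / 3\<close> splits as \<open>1 / 3 + 1\<close>: delayed feedback contributes \<open>\<gamma> * B \<le> B / 4 = r\<^sub>M / (3 * w)\<close> and uncoupled mass \<open>r\<^sub>M / w\<close>\<close>
  define B where "B = 4 * r\<^sub>M / (3 * w)"
  have B: "0 \<le> B" "r\<^sub>M \<le> B" using w \<open>r\<^sub>M > 0\<close> by (auto simp: B_def field_simps)
  show ?thesis
    unfolding w_def[symmetric]
  proof (intro exI[of _ l] conjI l(1) allI impI; elim conjE)
    fix n_ini I_ini n I nbar Ibar
    assume sol: "delayed_solution r r\<^sub>M d n_ini I_ini n I" and ss: "steady_state r r\<^sub>M nbar Ibar"
    have step: "L1_norm (\<lambda>x. n t x - nbar x) \<le> 2 / w * exp (- l * t) \<and> \<bar>I t - Ibar\<bar> \<le> B * exp (- l * t)"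
      if t: "0 \<le> t" and hist: "\<And>u. u \<in> {- d..t - d} \<Longrightarrow> \<bar>I u - Ibar\<bar> \<le> B * exp (- l * u)" for t
    proof -
      obtain v where v: "L1_norm (\<lambda>x. n t x - nbar x) \<le> 2 * v"
        "\<bar>I t - Ibar\<bar> \<le> \<gamma> * \<bar>I (t - d) - Ibar\<bar> + r\<^sub>M * v"
        "v \<le> exp (- r\<^sub>0 * t) + 2 * (LINT s:{0..t}|lebesgue. \<gamma> * \<bar>I (s - d) - Ibar\<bar> * exp (- r\<^sub>0 * (t - s)))"
        by (rule delayed_solution_estimates[OF r_meas _ \<open>r\<^sub>0 > 0\<close> _ lip _ \<open>d > 0\<close> sol ss t])
          (use r_bounds r_lower \<open>\<gamma> > 0\<close> in auto)
      define g where "g = exp (- l * t) - exp (- r\<^sub>0 * t)"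
      have g: "0 \<le> g" using l(4) t by (simp add: g_def mult_right_mono)
      have "(LINT s:{0..t}|lebesgue. \<gamma> * \<bar>I (s - d) - Ibar\<bar> * exp (- r\<^sub>0 * (t - s)))
          \<le> \<gamma> * B * exp (l * d) * (g / (r\<^sub>0 - l))"
        unfolding g_def using hist \<open>\<gamma> > 0\<close> B(1) l(4) t
        by (intro delayed_convolution_le[where h="\<lambda>u. \<bar>I u - Ibar\<bar>"]) auto
      then have "v \<le> exp (- r\<^sub>0 * t) + 2 * (\<gamma> * B * exp (l * d) * (g / (r\<^sub>0 - l)))"
        using v(3) by linarith
      also have "2 * (\<gamma> * B * exp (l * d) * (g / (r\<^sub>0 - l))) = (8 / 3 * \<gamma> * r\<^sub>M * exp (l * d)) / (r\<^sub>0 - l) * (g / w)"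
        using w l(4) by (simp add: B_def field_simps)
      also have "\<dots> \<le> 1 * (g / w)"
        using l(3,4) g w by (intro mult_right_mono) auto
      also have "exp (- r\<^sub>0 * t) + 1 * (g / w) \<le> exp (- r\<^sub>0 * t) / w + g / w"
        using w by (simp add: field_simps)
      also have "\<dots> = exp (- l * t) / w" by (simp add: g_def diff_divide_distrib)
      finally have v_le: "v \<le> exp (- l * t) / w" by simp
      have "\<gamma> * \<bar>I (t - d) - Ibar\<bar> \<le> \<gamma> * (B * exp (- l * (t - d)))"
        using \<open>\<gamma> > 0\<close> t by (intro mult_left_mono hist) auto
      also have "\<dots> = (4 * \<gamma> * exp (l * d)) * (B / 4 * exp (- l * t))"
        by (simp add: algebra_simps flip: exp_add)
      also have "\<dots> \<le> 1 * (B / 4 * exp (- l * t))"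
        using l(2) B(1) by (intro mult_right_mono) auto
      also have "\<dots> = r\<^sub>M / (3 * w) * exp (- l * t)" by (simp add: B_def)
      finally have "\<gamma> * \<bar>I (t - d) - Ibar\<bar> \<le> r\<^sub>M / (3 * w) * exp (- l * t)" .
      moreover have "r\<^sub>M * v \<le> r\<^sub>M * (exp (- l * t) / w)" using v_le \<open>r\<^sub>M > 0\<close> by (intro mult_left_mono) auto
      moreover have "r\<^sub>M / (3 * w) * exp (- l * t) + r\<^sub>M * (exp (- l * t) / w) = B * exp (- l * t)"
        using w by (simp add: B_def field_simps)
      ultimately have "\<bar>I t - Ibar\<bar> \<le> B * exp (- l * t)" using v(2) by linarith
      moreover have "L1_norm (\<lambda>x. n t x - nbar x) \<le> 2 / w * exp (- l * t)" using v(1) v_le by simp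
      ultimately show ?thesis by simp
    qed
    have init: "\<bar>I t - Ibar\<bar> \<le> B * exp (- l * t)" if "- d \<le> t" "t < 0" for t
    proof -
      have "I t \<in> {0..r\<^sub>M}" using sol that unfolding delayed_solution_def by blast
      moreover have "Ibar \<in> {0..r\<^sub>M}" using ss by (simp add: steady_state_def)
      ultimately have "\<bar>I t - Ibar\<bar> \<le> B * 1" using B by auto
      also have "\<dots> \<le> B * exp (- l * t)"
        using that l(1) B(1) by (intro mult_left_mono) (auto simp: mult_le_0_iff)
      finally show ?thesis .
    qed
    have all: "\<bar>I t - Ibar\<bar> \<le> B * exp (- l * t)" if "- d \<le> t" "t < real k * d" for k t
      using that
    proof (induction k arbitrary: t)
      case 0
      then show ?case using init by simp
    next
      case (Suc k)
      show ?case
      proof (cases "0 \<le> t")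
        case True
        have "t - d < real k * d" using Suc.prems by (simp add: algebra_simps)
        then show ?thesis using step[OF True] Suc.IH by auto
      next
        case False
        then show ?thesis using Suc.prems init by simp
      qed
    qed
    fix t :: real assume t: "0 \<le> t"
    have hist: "\<bar>I u - Ibar\<bar> \<le> B * exp (- l * u)" if "- d \<le> u" for u
    proof -
      obtain k :: nat where "u < real k * d" using reals_Archimedean3[OF \<open>d > 0\<close>] by blast
      then show ?thesis using all that by blast
    qed
    have "B * exp (- l * t) \<le> 2 * r\<^sub>M / w * exp (- l * t)"
      using w \<open>r\<^sub>M > 0\<close> by (intro mult_right_mono) (auto simp: B_def field_simps)
    then show "\<bar>I t - Ibar\<bar> \<le> 2 * r\<^sub>M / w * exp (- l * t)" using hist[of t] t \<open>d > 0\<close> by auto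
    show "L1_norm (\<lambda>x. n t x - nbar x) \<le> 2 / w * exp (- l * t)" using step[OF t] hist by auto
  qed
qed

end
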